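(* Let $\varphi$ be an algebraic $(\mathbb{C}^p,+)$-action on $\mathbb{C}^n$ satisfying condition $(H)$. Let $\mathcal{D}=\{\partial_1,\dots,\partial_p\}$ be its system of derivations and let $f_1,\dots,f_{n-p}$ generate its ring of invariants. Then there exists an invariant polynomial $E\in\mathbb{C}[x_1,\dots,x_n]^{\varphi}$ such that $[\mathcal{D}]=E\times J$, i.e. $[\mathcal{D}](R_1,\dots,R_p)=E\cdot J(R_1,\dots,R_p)$ for all polynomials $R_1,\dots,R_p\in\mathbb{C}[x_1,\dots,x_n]$.
   Context: An algebraic $(\mathbb{C}^p,+)$-action on $\mathbb{C}^n$ is a regular map $\varphi:\mathbb{C}^p\times\mathbb{C}^n\to\mathbb{C}^n$ with $\varphi(0,x)=x$ and $\varphi(u,\varphi(v,x))=\varphi(u+v,x)$. Its derivations are $\partial_i(f)=\frac{\partial}{\partial t_i}\big(f\circ\varphi(t_1,\dots,t_p;\cdot)\big)\big|_{t=0}$ for $i=1,\dots,p$; they are pairwise commuting, locally nilpotent derivations of $\mathbb{C}[x_1,\dots,x_n]$. The ring of invariants $\mathbb{C}[x_1,\dots,x_n]^{\varphi}$ is the set of polynomials $P$ with $P\circ\varphi=P$ (equivalently $\partial_i(P)=0$ for all $i$). Condition $(H)$: the ring of invariants is isomorphic to a polynomial ring in $n-p$ variables over $\mathbb{C}$; then $f_1,\dots,f_{n-p}$ denotes a set of generators of it. For polynomials $R_1,\dots,R_p$, set $[\mathcal{D}](R_1,\dots,R_p)=\det\big((\partial_i(R_j))_{i,j}\big)$ and $J(R_1,\dots,R_p)=\det(dR_1,\dots,dR_p,df_1,\dots,df_{n-p})$,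 the Jacobian determinant of $(R_1,\dots,R_p,f_1,\dots,f_{n-p})$. *)

theory Defs
  imports "HOL-Library.Poly_Mapping" "HOL.Complex" "HOL.Hull" "Jordan_Normal_Form.Determinant"
begin

text \<open>Finitely supported maps from monomials (exponent vectors) to coefficients; the ring
  operations are those of \<^theory>\<open>HOL-Library.Poly_Mapping\<close>.\<close>

type_synonym 'v cpoly = "('v \<Rightarrow>\<^sub>0 nat) \<Rightarrow>\<^sub>0 complex"

definition Const :: "complex \<Rightarrow> 'v cpoly" where
  "Const c = Poly_Mapping.single 0 c"

definition Var :: "'v \<Rightarrow> 'v cpoly" where
  "Var i = Poly_Mapping.single (Poly_Mapping.single i 1) 1"

text \<open>\<open>polys V\<close> is the ring of polynomials in the variables from \<open>V\<close>. In particular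
  \<open>polys {..<n} :: nat cpoly set\<close> is the polynomial ring over the complex numbers
  in the \<open>n\<close> variables \<open>Var 0, \<dots>, Var (n - 1)\<close>.\<close>

definition polys :: "'v set \<Rightarrow> 'v cpoly set" where
  "polys V = {P. \<forall>m \<in> Poly_Mapping.keys P. Poly_Mapping.keys m \<subseteq> V}"

definition eval_hom ::
  "(complex \<Rightarrow> 'b) \<Rightarrow> ('v \<Rightarrow> 'b) \<Rightarrow> 'v cpoly \<Rightarrow> 'b::comm_semiring_1" where
  "eval_hom c g P =
    (\<Sum>m \<in> Poly_Mapping.keys P. c (Poly_Mapping.lookup P m) *
       (\<Prod>i \<in> Poly_Mapping.keys m. g i ^ Poly_Mapping.lookup m i))"

definition eval_at :: "('v \<Rightarrow> complex) \<Rightarrow> 'v cpoly \<Rightarrow> complex" where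
  "eval_at = eval_hom (\<lambda>c. c)"

definition subst :: "('v \<Rightarrow> 'w cpoly) \<Rightarrow> 'v cpoly \<Rightarrow> 'w cpoly" where
  "subst = eval_hom Const"

text \<open>Formal partial derivative. The subtraction of exponent vectors is truncated, but a
  monomial not containing the variable \<open>i\<close> contributes with coefficient \<open>0\<close>.\<close>

definition pderivative :: "'v \<Rightarrow> 'v cpoly \<Rightarrow> 'v cpoly" where
  "pderivative i P =
    (\<Sum>m \<in> Poly_Mapping.keys P.
       Poly_Mapping.single (m - Poly_Mapping.single i 1)
         (of_nat (Poly_Mapping.lookup m i) * Poly_Mapping.lookup P m))"

definition subalgebra :: "'v cpoly set \<Rightarrow> bool" where
  "subalgebra A \<longleftrightarrow> range Const \<subseteq> A \<and> (\<forall>P\<in>A. \<forall>Q\<in>A. P + Q \<in> A \<and> P * Q \<in> A)"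

definition algebra_isomorphic :: "'v cpoly set \<Rightarrow> 'w cpoly set \<Rightarrow> bool" where
  "algebra_isomorphic A B \<longleftrightarrow>
    (\<exists>\<psi>. bij_betw \<psi> A B \<and> (\<forall>c. \<psi> (Const c) = Const c) \<and>
       (\<forall>P\<in>A. \<forall>Q\<in>A. \<psi> (P + Q) = \<psi> P + \<psi> Q \<and> \<psi> (P * Q) = \<psi> P * \<psi> Q))"

text \<open>A regular map \<open>\<phi>\<close> from the product of complex \<open>p\<close>-space and \<open>n\<close>-space to
  \<open>n\<close>-space is given by its coordinate polynomials \<open>\<Phi> 0, \<dots>, \<Phi> (n - 1)\<close>.
  In these, \<open>Var (Inl i)\<close> is the coordinate \<open>t\<^sub>i\<close> on the first factor and
  \<open>Var (Inr k)\<close> the coordinate \<open>x\<^sub>k\<close> on the second. All indices start at \<open>0\<close>.\<close>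

definition regular_map :: "nat \<Rightarrow> (nat \<Rightarrow> (nat + nat) cpoly) \<Rightarrow> complex vec \<Rightarrow> complex vec \<Rightarrow> complex vec" where
  "regular_map n \<Phi> u x = vec n (\<lambda>k. eval_at (case_sum (($) u) (($) x)) (\<Phi> k))"

definition algebraic_action :: "nat \<Rightarrow> nat \<Rightarrow> (nat \<Rightarrow> (nat + nat) cpoly) \<Rightarrow> bool" where
  "algebraic_action p n \<Phi> \<longleftrightarrow>
    (\<forall>k<n. \<Phi> k \<in> polys ({..<p} <+> {..<n})) \<and>
    (\<forall>x \<in> carrier_vec n. regular_map n \<Phi> (0\<^sub>v p) x = x) \<and>
    (\<forall>u \<in> carrier_vec p. \<forall>v \<in> carrier_vec p. \<forall>x \<in> carrier_vec n.
       regular_map n \<Phi> u (regular_map n \<Phi> v x) = regular_map n \<Phi> (u + v) x)"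

definition invariants :: "nat \<Rightarrow> nat \<Rightarrow> (nat \<Rightarrow> (nat + nat) cpoly) \<Rightarrow> nat cpoly set" where
  "invariants p n \<Phi> =
    {P \<in> polys {..<n}. \<forall>u \<in> carrier_vec p. \<forall>x \<in> carrier_vec n.
       eval_at (($) (regular_map n \<Phi> u x)) P = eval_at (($) x) P}"

text \<open>Here \<open>subst \<Phi> P\<close> is the composition of \<open>P\<close> with \<open>\<phi>\<close>, a polynomial in \<open>t\<close> and
  \<open>x\<close>; it is differentiated with respect to \<open>t\<^sub>i\<close>, and then \<open>t = 0\<close> is substituted.\<close>

definition action_derivation :: "(nat \<Rightarrow> (nat + nat) cpoly) \<Rightarrow> nat \<Rightarrow> nat cpoly \<Rightarrow> nat cpoly" where
  "action_derivation \<Phi> i P = subst (case_sum (\<lambda>_. 0) Var) (pderivative (Inl i) (subst \<Phi> P))"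

definition condition_H :: "nat \<Rightarrow> nat \<Rightarrow> (nat \<Rightarrow> (nat + nat) cpoly) \<Rightarrow> bool" where
  "condition_H p n \<Phi> \<longleftrightarrow>
    p \<le> n \<and> algebra_isomorphic (invariants p n \<Phi>) (polys {..<n - p} :: nat cpoly set)"

definition generators_of :: "nat \<Rightarrow> (nat \<Rightarrow> nat cpoly) \<Rightarrow> nat cpoly set \<Rightarrow> bool" where
  "generators_of r f A \<longleftrightarrow> subalgebra hull (f ` {..<r}) = A"

definition derivation_det ::
  "nat \<Rightarrow> (nat \<Rightarrow> (nat + nat) cpoly) \<Rightarrow> (nat \<Rightarrow> nat cpoly) \<Rightarrow> nat cpoly" where
  "derivation_det p \<Phi> R = det (mat p p (\<lambda>(i, j). action_derivation \<Phi> i (R j)))"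

text \<open>The Jacobian determinant of \<open>(R\<^sub>0, \<dots>, R\<^bsub>p-1\<^esub>, f\<^sub>0, \<dots>, f\<^bsub>n-p-1\<^esub>)\<close>.\<close>

definition jacobian_det ::
  "nat \<Rightarrow> nat \<Rightarrow> (nat \<Rightarrow> nat cpoly) \<Rightarrow> (nat \<Rightarrow> nat cpoly) \<Rightarrow> nat cpoly" where
  "jacobian_det p n f R =
    det (mat n n (\<lambda>(i, j). pderivative j (if i < p then R i else f (i - p))))"

end

theory Submission
  imports Defs
begin

text \<open>
  Write \<open>S\<close> for the polynomial ring in \<open>x\<^sub>0, \<dots>, x\<^bsub>n-1\<^esub>\<close>, \<open>A\<close> for the ring of invariants,
  \<open>m = n - p\<close>, and \<open>J\<close> for the Jacobian determinant as a function of \<open>R\<close>. Both \<open>[D]\<close> and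
  \<open>J\<close> are alternating \<open>p\<close>-derivations of \<open>S\<close> that vanish as soon as one argument is an invariant.
  Over the fraction field there is only one of these up to a factor, and \<open>J\<close> is not zero; so
  \<open>h [D] = a J\<close> with \<open>a, h\<close> in \<open>S\<close> and \<open>h \<noteq> 0\<close> (\<open>derivation_det_proportional\<close>). The
  theorem says that \<open>h\<close> can be cancelled.

  As \<open>S\<close> is factorial (\<open>irreducible_in_imp_prime_in\<close>), a prime factor \<open>b\<close> of \<open>h\<close> that does not
  divide \<open>a\<close> divides all values of \<open>J\<close>. Such a prime is an invariant: the derivative
  \<open>\<partial>\<^sub>i (J R)\<close> is a combination of values of \<open>J\<close> (\<open>vector_field_jacobian_det\<close>), which forces \<open>b\<close> to
  divide \<open>\<partial>\<^sub>i b\<close>, and then \<open>\<partial>\<^sub>i b = 0\<close> because \<open>\<partial>\<^sub>i\<close> is locally nilpotent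
  (\<open>prime_divisor_of_jacobian_invariant\<close>).

  But \<open>J\<close> does not vanish modulo an invariant prime \<open>b\<close> (\<open>jacobian_det_nonzero_modulo_prime\<close>);
  this is the heart of the proof. Write \<open>b = B(f)\<close>. As \<open>A\<close> contains every factor of each of its
  nonzero elements, the \<open>f\<^sub>i\<close> satisfy on the hypersurface \<open>b = 0\<close> no relations but the multiples
  of \<open>B\<close>, and so all but one of them are algebraically independent there. In
  characteristic zero, algebraically independent functions have independent differentials, so those
  of these \<open>m - 1\<close> functions are independent modulo \<open>db\<close>. Since \<open>db\<close> is itself the combination
  \<open>\<Sum> \<partial>B/\<partial>y\<^sub>i(f) df\<^sub>i\<close>, the differentials \<open>df\<^sub>0, \<dots>, df\<^bsub>m-1\<^esub>\<close> are independent at the general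
  point of the hypersurface, where therefore \<open>J\<close> does not vanish. Transcendence degrees enter only
  through a dimension count (\<open>algebraically_dependent_modulo\<close>).

  So \<open>E = a / h\<close> is a polynomial. Differentiating \<open>[D] = E J\<close> gives \<open>\<partial>\<^sub>i E = \<tau>\<^sub>i E\<close>, where
  \<open>\<tau>\<^sub>i\<close> is the divergence of \<open>\<partial>\<^sub>i\<close>, and local nilpotency shows again that \<open>\<partial>\<^sub>i E = 0\<close>.
\<close>

section \<open>Polynomials as a free commutative algebra\<close>

lemma polys_UNIV [simp]: "polys UNIV = UNIV"
  by (simp add: polys_def)

lemma polys_mono: "V \<subseteq> W \<Longrightarrow> polys V \<subseteq> polys W"
  unfolding polys_def by blast

lemma Const_0 [simp]: "Const 0 = 0"
  by (simp add: Const_def)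

lemma Const_1 [simp]: "Const 1 = 1"
  by (simp add: Const_def)

lemma Const_add: "Const (a + b) = Const a + Const b"
  by (simp add: Const_def single_add)

lemma Const_mult: "Const (a * b) = Const a * Const b"
  by (simp add: Const_def mult_single)

lemma Const_eq_iff [simp]: "Const a = Const b \<longleftrightarrow> a = b"
  by (metis Const_def lookup_single_eq)

lemma Const_eq_0_iff [simp]: "Const a = 0 \<longleftrightarrow> a = 0"
  using Const_eq_iff[of a 0] by simp

lemma Const_in_polys [simp]: "Const c \<in> polys V"
  by (auto simp: Const_def polys_def split: if_splits)

lemma Var_in_polys [simp]: "i \<in> V \<Longrightarrow> Var i \<in> polys V"
  by (auto simp: Var_def polys_def split: if_splits)

lemma polys_add [simp]: "P \<in> polys V \<Longrightarrow> Q \<in> polys V \<Longrightarrow> P + Q \<in> polys V"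
  unfolding polys_def using keys_add[of P Q] by blast

lemma polys_mult [simp]: 
  assumes "P \<in> polys V" "Q \<in> polys V" shows "P * Q \<in> polys V"
proof -
  have "Poly_Mapping.keys m \<subseteq> V" if "m \<in> Poly_Mapping.keys (P * Q)" for m
  proof -
    obtain a b where "m = a + b" "a \<in> Poly_Mapping.keys P" "b \<in> Poly_Mapping.keys Q"
      using keys_mult[of P Q] \<open>m \<in> _\<close> by blast
    thus ?thesis using assms keys_add[of a b] unfolding polys_def by blast
  qed
  thus ?thesis by (simp add: polys_def)
qed

lemma polys_0 [simp]: "0 \<in> polys V"
  by (simp add: polys_def)

lemma polys_1 [simp]: "1 \<in> polys V"
  using Const_in_polys[of 1] by simp

lemma polys_uminus [simp]: "P \<in> polys V \<Longrightarrow> - P \<in> polys V"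
  by (simp add: polys_def)

lemma polys_diff [simp]: "P \<in> polys V \<Longrightarrow> Q \<in> polys V \<Longrightarrow> P - Q \<in> polys V"
  using polys_add[of P V "- Q"] by simp

lemma polys_sum [simp]: "(\<And>i. i \<in> I \<Longrightarrow> F i \<in> polys V) \<Longrightarrow> sum F I \<in> polys V"
  by (induction I rule: infinite_finite_induct) auto

lemma polys_prod [simp]: "(\<And>i. i \<in> I \<Longrightarrow> F i \<in> polys V) \<Longrightarrow> prod F I \<in> polys V"
  by (induction I rule: infinite_finite_induct) auto

lemma polys_power [simp]: "P \<in> polys V \<Longrightarrow> P ^ k \<in> polys V"
  by (induction k) auto

lemma sum_of_monomials: "P = (\<Sum>m\<in>Poly_Mapping.keys P. Poly_Mapping.single m (Poly_Mapping.lookup P m))"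
  by (rule poly_mapping_eqI) (auto simp: lookup_sum lookup_single when_def in_keys_iff)

lemma Var_power: "Var i ^ k = Poly_Mapping.single (Poly_Mapping.single i k) 1"
  by (induction k) (auto simp: Var_def mult_single single_add[symmetric])

lemma prod_single_one:
  "finite I \<Longrightarrow> (\<Prod>i\<in>I. Poly_Mapping.single (e i) (1::complex)) = Poly_Mapping.single (\<Sum>i\<in>I. e i) 1"
  by (induction I rule: finite_induct) (auto simp: mult_single)

lemma single_eq_Const_mult_Vars:
  "Poly_Mapping.single m c = Const c * (\<Prod>i\<in>Poly_Mapping.keys m. Var i ^ Poly_Mapping.lookup m i)"
  using sum_of_monomials[of m] by (simp add: Var_power prod_single_one Const_def mult_single)

text \<open>Two ring homomorphisms, or two derivations, that agree on constants and variables agree: most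
  identities below are instances of this induction.\<close>

lemma polys_induct [consumes 1, case_names Const Var add mult]:
  assumes "P \<in> polys V"
    and "\<And>c. Q (Const c)" and "\<And>i. i \<in> V \<Longrightarrow> Q (Var i)"
    and add: "\<And>A B. A \<in> polys V \<Longrightarrow> B \<in> polys V \<Longrightarrow> Q A \<Longrightarrow> Q B \<Longrightarrow> Q (A + B)"
    and mult: "\<And>A B. A \<in> polys V \<Longrightarrow> B \<in> polys V \<Longrightarrow> Q A \<Longrightarrow> Q B \<Longrightarrow> Q (A * B)"
  shows "Q P"
proof -
  have Q1: "Q 1" and Q0: "Q 0"
    using assms(2)[of 1] assms(2)[of 0] by simp_all
  have pw: "A ^ k \<in> polys V \<and> Q (A ^ k)" if "A \<in> polys V" "Q A" for A k
    by (induction k) (use that Q1 mult in auto)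
  have pr: "(\<Prod>i\<in>I. F i) \<in> polys V \<and> Q (\<Prod>i\<in>I. F i)"
    if "\<And>i. i \<in> I \<Longrightarrow> F i \<in> polys V \<and> Q (F i)" for F :: "'a \<Rightarrow> 'a cpoly" and I
    using that by (induction I rule: infinite_finite_induct) (use Q1 mult in auto)
  have mon: "Poly_Mapping.single m c \<in> polys V \<and> Q (Poly_Mapping.single m c)"
    if "Poly_Mapping.keys m \<subseteq> V" for m c
  proof -
    have "(\<Prod>i\<in>Poly_Mapping.keys m. Var i ^ Poly_Mapping.lookup m i) \<in> polys V
       \<and> Q (\<Prod>i\<in>Poly_Mapping.keys m. Var i ^ Poly_Mapping.lookup m i)"
      using that by (intro pr pw) (auto intro: assms(3))
    thus ?thesis unfolding single_eq_Const_mult_Vars[of m c] by (auto intro: mult assms(2))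
  qed
  have "(\<Sum>m\<in>I. Poly_Mapping.single m (c m)) \<in> polys V \<and> Q (\<Sum>m\<in>I. Poly_Mapping.single m (c m))"
    if "\<And>m. m \<in> I \<Longrightarrow> Poly_Mapping.keys m \<subseteq> V" for I c
    using that by (induction I rule: infinite_finite_induct) (use Q0 mon add in auto)
  moreover have "\<And>m. m \<in> Poly_Mapping.keys P \<Longrightarrow> Poly_Mapping.keys m \<subseteq> V"
    using assms(1) by (simp add: polys_def)
  ultimately have "Q (\<Sum>m\<in>Poly_Mapping.keys P. Poly_Mapping.single m (Poly_Mapping.lookup P m))" by blast
  thus ?thesis by (simp only: sum_of_monomials[symmetric])
qed

lemmas cpoly_induct = polys_induct[where V = UNIV, simplified, case_names Const Var add mult]

definition coefficient_hom :: "(complex \<Rightarrow> 'b::comm_semiring_1) \<Rightarrow> bool" where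
  "coefficient_hom c \<longleftrightarrow> c 0 = 0 \<and> c 1 = 1 \<and> (\<forall>a b. c (a + b) = c a + c b \<and> c (a * b) = c a * c b)"

lemma coefficient_hom_id: "coefficient_hom (\<lambda>c. c)"
  by (simp add: coefficient_hom_def)

lemma coefficient_hom_Const: "coefficient_hom Const"
  by (simp add: coefficient_hom_def Const_add Const_mult)

lemma eval_hom_single:
  assumes "coefficient_hom c"
  shows "eval_hom c g (Poly_Mapping.single m a) =
    c a * (\<Prod>i\<in>Poly_Mapping.keys m. g i ^ Poly_Mapping.lookup m i)"
  using assms by (auto simp: eval_hom_def coefficient_hom_def)

lemma eval_hom_0 [simp]: "eval_hom c g 0 = 0"
  by (simp add: eval_hom_def)

lemma eval_hom_add:
  assumes "coefficient_hom c"
  shows "eval_hom c g (P + Q) = eval_hom c g P + eval_hom c g Q"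
  unfolding eval_hom_def using assms
  by (intro setsum_keys_plus_distrib) (auto simp: coefficient_hom_def distrib_right)

lemma eval_hom_sum:
  assumes "coefficient_hom c"
  shows "eval_hom c g (sum F I) = (\<Sum>i\<in>I. eval_hom c g (F i))"
  by (induction I rule: infinite_finite_induct) (auto simp: eval_hom_add[OF assms])

lemma monomial_value_add:
  fixes g :: "'v \<Rightarrow> 'b::comm_semiring_1"
  shows "(\<Prod>i\<in>Poly_Mapping.keys (m + m'). g i ^ Poly_Mapping.lookup (m + m') i) =
    (\<Prod>i\<in>Poly_Mapping.keys m. g i ^ Poly_Mapping.lookup m i) *
    (\<Prod>i\<in>Poly_Mapping.keys m'. g i ^ Poly_Mapping.lookup m' i)"
proof -
  let ?K = "Poly_Mapping.keys m \<union> Poly_Mapping.keys m'"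
  have ext: "(\<Prod>i\<in>Poly_Mapping.keys l. g i ^ Poly_Mapping.lookup l i) = (\<Prod>i\<in>?K. g i ^ Poly_Mapping.lookup l i)"
    if "Poly_Mapping.keys l \<subseteq> ?K" for l
    by (rule prod.mono_neutral_left) (use that in \<open>auto simp: in_keys_iff\<close>)
  show ?thesis
    unfolding ext[OF keys_add] ext[OF Un_upper1] ext[OF Un_upper2]
    by (simp add: lookup_add power_add prod.distrib)
qed

lemma eval_hom_mult:
  assumes "coefficient_hom c"
  shows "eval_hom c g (P * Q) = eval_hom c g P * eval_hom c g Q"
proof -
  have c: "c (a * b) = c a * c b" for a b using assms by (simp add: coefficient_hom_def)
  let ?s = "\<lambda>P m. Poly_Mapping.single m (Poly_Mapping.lookup P m)"
  have "P * Q = (\<Sum>m\<in>Poly_Mapping.keys P. \<Sum>m'\<in>Poly_Mapping.keys Q. ?s P m * ?s Q m')"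
    by (simp only: sum_product[symmetric] sum_of_monomials[symmetric])
  hence "eval_hom c g (P * Q) =
      (\<Sum>m\<in>Poly_Mapping.keys P. \<Sum>m'\<in>Poly_Mapping.keys Q. eval_hom c g (?s P m) * eval_hom c g (?s Q m'))"
    by (simp add: eval_hom_sum[OF assms] mult_single eval_hom_single[OF assms] c monomial_value_add ac_simps)
  also have "\<dots> = eval_hom c g (\<Sum>m\<in>Poly_Mapping.keys P. ?s P m) * eval_hom c g (\<Sum>m\<in>Poly_Mapping.keys Q. ?s Q m)"
    by (simp add: sum_product eval_hom_sum[OF assms])
  finally show ?thesis by (simp only: sum_of_monomials[symmetric])
qed

lemma eval_hom_Const: "coefficient_hom c \<Longrightarrow> eval_hom c g (Const a) = c a"
  unfolding Const_def by (simp add: eval_hom_single)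

lemma eval_hom_Var: "coefficient_hom c \<Longrightarrow> eval_hom c g (Var i) = g i"
  unfolding Var_def by (simp add: eval_hom_single coefficient_hom_def)

lemmas eval_hom_simps = eval_hom_Const eval_hom_Var eval_hom_add eval_hom_mult

lemma subst_simps [simp]:
  "subst s (Const a) = Const a" "subst s (Var i) = s i" "subst s 0 = 0" "subst s 1 = 1"
  "subst s (P + Q) = subst s P + subst s Q" "subst s (P * Q) = subst s P * subst s Q"
  using eval_hom_Const[OF coefficient_hom_Const, of s 1]
  by (simp_all add: subst_def eval_hom_simps[OF coefficient_hom_Const])

lemma eval_at_simps [simp]:
  "eval_at s (Const a) = a" "eval_at s (Var i) = s i" "eval_at s 0 = 0" "eval_at s 1 = 1"
  "eval_at s (P + Q) = eval_at s P + eval_at s Q" "eval_at s (P * Q) = eval_at s P * eval_at s Q"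
  using eval_hom_Const[OF coefficient_hom_id, of s 1]
  by (simp_all add: eval_at_def eval_hom_simps[OF coefficient_hom_id])

lemma subst_uminus [simp]: "subst s (- P) = - subst s P"
  using subst_simps(5)[of s "- P" P] by (simp add: eq_neg_iff_add_eq_0)

lemma subst_diff [simp]: "subst s (P - Q) = subst s P - subst s Q"
  using subst_simps(5)[of s P "- Q"] by simp

lemma subst_sum [simp]: "subst s (sum F I) = (\<Sum>i\<in>I. subst s (F i))"
  by (induction I rule: infinite_finite_induct) auto

lemma eval_at_diff [simp]: "eval_at s (P - Q) = eval_at s P - eval_at s Q"
  using eval_at_simps(5)[of s "P - Q" Q] by simp

lemma eval_at_subst: "eval_at g (subst s P) = eval_at (\<lambda>i. eval_at g (s i)) P"
  by (induction P rule: cpoly_induct) auto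

lemma subst_subst: "subst g (subst s P) = subst (\<lambda>i. subst g (s i)) P"
  by (induction P rule: cpoly_induct) auto

lemma subst_cong: "P \<in> polys V \<Longrightarrow> (\<And>i. i \<in> V \<Longrightarrow> s i = s' i) \<Longrightarrow> subst s P = subst s' P"
  by (induction P rule: polys_induct) auto

lemma eval_at_cong: "P \<in> polys V \<Longrightarrow> (\<And>i. i \<in> V \<Longrightarrow> s i = s' i) \<Longrightarrow> eval_at s P = eval_at s' P"
  by (induction P rule: polys_induct) auto

lemma subst_Var [simp]: "subst Var P = P"
  by (induction P rule: cpoly_induct) auto

lemma subst_in_polys:
  "P \<in> polys V \<Longrightarrow> (\<And>i. i \<in> V \<Longrightarrow> s i \<in> polys W) \<Longrightarrow> subst s P \<in> polys W"
  by (induction P rule: polys_induct) auto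

section \<open>Partial derivatives\<close>

lemma pderivative_0 [simp]: "pderivative v 0 = 0"
  by (simp add: pderivative_def)

lemma pderivative_add [simp]: "pderivative v (P + Q) = pderivative v P + pderivative v Q"
  unfolding pderivative_def
  by (intro setsum_keys_plus_distrib) (auto simp: distrib_left single_add)

lemma pderivative_sum: "pderivative v (sum F I) = (\<Sum>i\<in>I. pderivative v (F i))"
  by (induction I rule: infinite_finite_induct) auto

lemma pderivative_single:
  "pderivative v (Poly_Mapping.single m a) =
    Poly_Mapping.single (m - Poly_Mapping.single v 1) (of_nat (Poly_Mapping.lookup m v) * a)"
  by (auto simp: pderivative_def)

lemma pderivative_Const [simp]: "pderivative v (Const c) = 0"
  by (simp add: Const_def pderivative_single)

lemma pderivative_1 [simp]: "pderivative v 1 = 0"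
  using pderivative_Const[of v 1] by simp

lemma pderivative_Var: "pderivative v (Var i) = (if i = v then 1 else 0)"
  by (auto simp: Var_def pderivative_single lookup_single)

lemma single_mult_pderivative_single:
  fixes m m' :: "'v \<Rightarrow>\<^sub>0 nat" and a b :: complex
  shows "Poly_Mapping.single m' b * pderivative v (Poly_Mapping.single m a) =
    Poly_Mapping.single (m + m' - Poly_Mapping.single v 1) (of_nat (Poly_Mapping.lookup m v) * a * b)"
proof (cases "Poly_Mapping.lookup m v = 0")
  case False
  have "m' + (m - Poly_Mapping.single v 1) = m + m' - Poly_Mapping.single v 1"
    using False by (intro poly_mapping_eqI) (auto simp: lookup_add lookup_minus lookup_single when_def)
  thus ?thesis by (simp add: pderivative_single mult_single ac_simps)
qed (simp add: pderivative_single)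

lemma pderivative_mult [simp]:
  "pderivative v (P * Q) = P * pderivative v Q + pderivative v P * Q"
proof -
  let ?s = "\<lambda>P m. Poly_Mapping.single m (Poly_Mapping.lookup P m)"
  have single: "pderivative v (Poly_Mapping.single m a * Poly_Mapping.single m' b) =
      Poly_Mapping.single m a * pderivative v (Poly_Mapping.single m' b) +
      pderivative v (Poly_Mapping.single m a) * Poly_Mapping.single m' b" for m m' :: "'a \<Rightarrow>\<^sub>0 nat" and a b
  proof -
    have "pderivative v (Poly_Mapping.single m a * Poly_Mapping.single m' b) =
      Poly_Mapping.single (m + m' - Poly_Mapping.single v 1)
        (of_nat (Poly_Mapping.lookup m' v) * b * a + of_nat (Poly_Mapping.lookup m v) * a * b)"
      by (simp add: mult_single pderivative_single lookup_add algebra_simps)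
    thus ?thesis
      using single_mult_pderivative_single[of m' b v m a] single_mult_pderivative_single[of m a v m' b]
      by (simp add: single_add ac_simps)
  qed
  have PQ: "P * Q = (\<Sum>m\<in>Poly_Mapping.keys P. \<Sum>m'\<in>Poly_Mapping.keys Q. ?s P m * ?s Q m')"
    by (simp only: sum_product[symmetric] sum_of_monomials[symmetric])
  have "P * pderivative v Q + pderivative v P * Q =
    (\<Sum>m\<in>Poly_Mapping.keys P. ?s P m) * pderivative v (\<Sum>m\<in>Poly_Mapping.keys Q. ?s Q m) +
    pderivative v (\<Sum>m\<in>Poly_Mapping.keys P. ?s P m) * (\<Sum>m\<in>Poly_Mapping.keys Q. ?s Q m)"
    by (simp only: sum_of_monomials[symmetric])
  also have "\<dots> = (\<Sum>m\<in>Poly_Mapping.keys P. \<Sum>m'\<in>Poly_Mapping.keys Q.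
      pderivative v (?s P m * ?s Q m'))"
    unfolding single pderivative_sum by (simp add: sum_product sum.distrib)
  finally show ?thesis unfolding PQ by (simp add: pderivative_sum)
qed

lemma pderivative_in_polys: "P \<in> polys V \<Longrightarrow> pderivative v P \<in> polys V"
  by (induction P rule: polys_induct) (auto simp: pderivative_Var)

lemma pderivative_outside: "P \<in> polys V \<Longrightarrow> v \<notin> V \<Longrightarrow> pderivative v P = 0"
  by (induction P rule: polys_induct) (auto simp: pderivative_Var)

text \<open>The chain rule. The finite set \<open>V\<close> stands in for the type of all variables, over which one
  cannot sum.\<close>

lemma pderivative_subst:
  assumes "P \<in> polys V" "finite V"
  shows "pderivative k (subst s P) = (\<Sum>v\<in>V. subst s (pderivative v P) * pderivative k (s v))"
  using assms(1)
proof (induction P rule: polys_induct)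
  case (Var i)
  have "(\<Sum>v\<in>V. subst s (pderivative v (Var i)) * pderivative k (s v)) =
    (\<Sum>v\<in>V. if v = i then pderivative k (s v) else 0)"
    by (rule sum.cong) (auto simp: pderivative_Var)
  thus ?case using Var assms(2) by simp
qed (simp_all add: sum.distrib sum_distrib_left distrib_right algebra_simps)

lemma lookup_pderivative:
  "Poly_Mapping.lookup (pderivative v P) m =
    of_nat (Suc (Poly_Mapping.lookup m v)) * Poly_Mapping.lookup P (m + Poly_Mapping.single v 1)"
proof -
  have eq: "l - Poly_Mapping.single v 1 = m \<longleftrightarrow> l = m + Poly_Mapping.single v 1"
    if "Poly_Mapping.lookup l v \<noteq> 0" for l :: "'a \<Rightarrow>\<^sub>0 nat"
    using that by (auto simp: poly_mapping_eq_iff fun_eq_iff lookup_add lookup_minus lookup_single when_def)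
  have "Poly_Mapping.lookup (pderivative v P) m =
    (\<Sum>l\<in>Poly_Mapping.keys P. if l = m + Poly_Mapping.single v 1 then
      of_nat (Poly_Mapping.lookup l v) * Poly_Mapping.lookup P l else 0)"
    unfolding pderivative_def lookup_sum lookup_single when_def
  proof (intro sum.cong refl)
    fix l assume "l \<in> Poly_Mapping.keys P"
    show "(if l - Poly_Mapping.single v 1 = m then of_nat (Poly_Mapping.lookup l v) * Poly_Mapping.lookup P l else 0)
      = (if l = m + Poly_Mapping.single v 1 then of_nat (Poly_Mapping.lookup l v) * Poly_Mapping.lookup P l else 0)"
      using eq[of l] by (cases "Poly_Mapping.lookup l v = 0") auto
  qed
  thus ?thesis
    by (simp add: lookup_add in_keys_iff)
qed

text \<open>A bound instead of a degree, so that the zero polynomial needs no convention.\<close>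

definition var_degree_le :: "'v \<Rightarrow> 'v cpoly \<Rightarrow> nat \<Rightarrow> bool" where
  "var_degree_le v P d \<longleftrightarrow> (\<forall>m\<in>Poly_Mapping.keys P. Poly_Mapping.lookup m v \<le> d)"

lemma var_degree_le_exists: "\<exists>d. var_degree_le v P d"
  unfolding var_degree_le_def
  by (rule exI[of _ "Max ((\<lambda>m. Poly_Mapping.lookup m v) ` Poly_Mapping.keys P)"]) auto

lemma var_degree_le_pderivative:
  assumes "var_degree_le v P (Suc d)" shows "var_degree_le v (pderivative v P) d"
  unfolding var_degree_le_def
proof
  fix m assume "m \<in> Poly_Mapping.keys (pderivative v P)"
  hence "m + Poly_Mapping.single v 1 \<in> Poly_Mapping.keys P"
    by (auto simp: in_keys_iff lookup_pderivative)
  thus "Poly_Mapping.lookup m v \<le> d"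
    using assms by (force simp: var_degree_le_def lookup_add)
qed

lemma pderivative_eq_0_imp:
  assumes "pderivative v P = 0" "m \<in> Poly_Mapping.keys P" shows "Poly_Mapping.lookup m v = 0"
proof (rule ccontr)
  assume nz: "Poly_Mapping.lookup m v \<noteq> 0"
  have "m - Poly_Mapping.single v 1 + Poly_Mapping.single v 1 = m"
    using nz by (intro poly_mapping_eqI) (auto simp: lookup_add lookup_minus lookup_single when_def)
  with lookup_pderivative[of v P "m - Poly_Mapping.single v 1"] assms
  have "Poly_Mapping.lookup P m = 0"
    by (metis lookup_zero mult_eq_0_iff of_nat_neq_0)
  with assms(2) show False by (simp add: in_keys_iff)
qed

lemma pderivative_eq_0_imp_polys:
  assumes "pderivative v P = 0" "P \<in> polys V" shows "P \<in> polys (V - {v})"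
  using assms(2) pderivative_eq_0_imp[OF assms(1)] unfolding polys_def
  by (auto simp: in_keys_iff)

lemma var_degree_le_0_imp:
  assumes "var_degree_le v P 0" "P \<in> polys V" shows "P \<in> polys (V - {v})"
  using assms unfolding polys_def var_degree_le_def
  by (auto simp: in_keys_iff)

lemma pderivative_funpow_eq_0:
  "var_degree_le v P d \<Longrightarrow> (pderivative v ^^ Suc d) P = 0"
proof (induction d arbitrary: P)
  case 0
  have "P \<in> polys (UNIV - {v})" by (rule var_degree_le_0_imp[OF 0]) simp
  thus ?case using pderivative_outside by fastforce
next
  case (Suc d)
  from Suc.IH[OF var_degree_le_pderivative[OF Suc.prems]]
  show ?case by (simp only: funpow_Suc_right o_apply)
qed

lemma pderivative_commute: "pderivative i (pderivative j P) = pderivative j (pderivative i P)"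
  by (induction P rule: cpoly_induct) (auto simp: pderivative_Var)

text \<open>With this, identities between polynomial functions, such as the group law of an action, can be
  differentiated.\<close>

lemma has_field_derivative_eval_at:
  "((\<lambda>z. eval_at (g(v := g v + z)) P) has_field_derivative eval_at g (pderivative v P)) (at 0)"
proof (induction P rule: cpoly_induct)
  case (Var i)
  show ?case by (cases "i = v") (auto simp: pderivative_Var intro!: derivative_eq_intros)
next
  case (mult A B)
  show ?case using DERIV_mult[OF mult] by (simp add: algebra_simps)
qed (auto intro!: derivative_eq_intros)

lemma pderivative_vanishes:
  assumes "\<And>g. eval_at g P = 0" shows "eval_at g (pderivative v P) = 0"
proof -
  have "((\<lambda>z. 0) has_field_derivative eval_at g (pderivative v P)) (at (0::complex))"
    using has_field_derivative_eval_at[of g v P] assms by simp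
  thus ?thesis using DERIV_unique DERIV_const by blast
qed

text \<open>The derivatives of \<open>P\<close> vanish everywhere, too. By induction on the degree in \<open>v\<close> the derivative
  with respect to \<open>v\<close> is zero, so \<open>v\<close> does not occur in \<open>P\<close>, and the variables disappear one by one.\<close>

lemma eq_0_if_vanishes:
  assumes "P \<in> polys V" "finite V" "\<And>g. eval_at g P = 0"
  shows "P = 0"
  using assms(2,1,3)
proof (induction V arbitrary: P rule: finite_induct)
  case empty
  hence "P = Const (Poly_Mapping.lookup P 0)"
    by (intro poly_mapping_eqI) (auto simp: Const_def polys_def lookup_single when_def in_keys_iff)
  with empty.prems(2) show ?case by (metis Const_0 eval_at_simps(1))
next
  case (insert v V)
  have key: "P = 0" if "P \<in> polys (insert v V)" "\<And>g. eval_at g P = 0" "var_degree_le v P d" for P d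
    using that
  proof (induction d arbitrary: P)
    case 0
    have "P \<in> polys (insert v V - {v})" by (rule var_degree_le_0_imp[OF 0(3,1)])
    thus ?case using insert.IH insert.hyps 0 by simp
  next
    case (Suc d)
    have "pderivative v P = 0"
      using Suc.prems by (intro Suc.IH pderivative_in_polys pderivative_vanishes var_degree_le_pderivative)
    from pderivative_eq_0_imp_polys[OF this Suc.prems(1)]
    show ?case using insert.IH insert.hyps Suc.prems by simp
  qed
  obtain d where "var_degree_le v P d" using var_degree_le_exists[of v P] ..
  thus ?case by (rule key[OF insert.prems])
qed

lemma eq_if_eval_at_eq:
  assumes "P \<in> polys V" "Q \<in> polys V" "finite V" "\<And>g. eval_at g P = eval_at g Q"
  shows "P = Q"
  using eq_0_if_vanishes[of "P - Q" V] assms by simp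

section \<open>Degrees\<close>

text \<open>The coefficients stay in the type of the polynomial itself, which is a domain; so degrees in the
  variable \<open>v\<close> are additive, and coefficients and polynomials can be multiplied.\<close>

definition univariate :: "nat \<Rightarrow> nat cpoly \<Rightarrow> nat cpoly poly" where
  "univariate v = eval_hom (\<lambda>c. [:Const c:]) (\<lambda>i. if i = v then [:0, 1:] else [:Var i:])"

text \<open>The substitution of \<open>x\<^sub>i T\<close> for each variable \<open>x\<^sub>i\<close>: the degree in \<open>T\<close> is the total degree, which is
  additive because the substitution is a homomorphism into the polynomials over a domain.\<close>

definition homogenize :: "nat cpoly \<Rightarrow> nat cpoly poly" where
  "homogenize = eval_hom (\<lambda>c. [:Const c:]) (\<lambda>i. [:0, Var i:])"

lemma coefficient_hom_pCons: "coefficient_hom (\<lambda>c. [:Const c:])"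
  by (simp add: coefficient_hom_def Const_add Const_mult mult.commute)

lemma univariate_simps [simp]:
  "univariate v (Const a) = [:Const a:]"
  "univariate v (Var i) = (if i = v then [:0, 1:] else [:Var i:])" "univariate v 0 = 0"
  "univariate v (P + Q) = univariate v P + univariate v Q"
  "univariate v (P * Q) = univariate v P * univariate v Q"
  by (simp_all add: univariate_def eval_hom_simps[OF coefficient_hom_pCons])

lemma homogenize_simps [simp]:
  "homogenize (Const a) = [:Const a:]" "homogenize (Var i) = [:0, Var i:]" "homogenize 0 = 0"
  "homogenize (P + Q) = homogenize P + homogenize Q"
  "homogenize (P * Q) = homogenize P * homogenize Q"
  by (simp_all add: homogenize_def eval_hom_simps[OF coefficient_hom_pCons])

lemma univariate_diff [simp]: "univariate v (P - Q) = univariate v P - univariate v Q"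
  using univariate_simps(4)[of v "P - Q" Q] by simp

lemma univariate_1 [simp]: "univariate v 1 = 1"
  using univariate_simps(1)[of v 1] by simp

lemma univariate_Var_power: "univariate v (Var v ^ k) = monom 1 k"
  by (induction k) (auto simp: monom_Suc monom_0)

lemma poly_univariate: "poly (univariate v P) (Var v) = P"
  by (induction P rule: cpoly_induct) auto

lemma univariate_eq_0_iff [simp]: "univariate v P = 0 \<longleftrightarrow> P = 0"
  using poly_univariate[of v P] by auto

lemma univariate_constant: "P \<in> polys V \<Longrightarrow> v \<notin> V \<Longrightarrow> univariate v P = [:P:]"
  by (induction P rule: polys_induct) (auto simp: mult.commute)

lemma coeff_univariate_in_polys:
  "P \<in> polys (insert v V) \<Longrightarrow> coeff (univariate v P) k \<in> polys V"
proof (induction P arbitrary: k rule: polys_induct)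
  case (Const c) show ?case by (cases k) auto
next
  case (Var i) thus ?case by (cases k) (auto simp: coeff_pCons split: nat.split)
qed (auto simp: coeff_mult)

lemma degree_univariate_eq_0_imp:
  assumes "degree (univariate v P) = 0" "P \<in> polys (insert v V)" shows "P \<in> polys V"
proof -
  obtain a where a: "univariate v P = [:a:]" using assms(1) by (rule degree_eq_zeroE)
  with coeff_univariate_in_polys[OF assms(2), of 0] poly_univariate[of v P] show ?thesis by simp
qed

text \<open>Degrees in each variable add up, so a factor contains no variable that is missing from the
  product. Hence divisibility within \<open>polys V\<close> is divisibility in the whole ring, and one relation
  \<open>dvd\<close> serves for all sets of variables.\<close>

lemma polys_factor:
  fixes P Q :: "nat cpoly"
  assumes "P * Q \<in> polys V" "P * Q \<noteq> 0" shows "Q \<in> polys V"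
proof -
  have "Q \<in> polys (UNIV - {v})" if "v \<notin> V" for v
  proof -
    have "univariate v (P * Q) = [:P * Q:]" by (rule univariate_constant[OF assms(1) that])
    hence "degree (univariate v P * univariate v Q) = 0"
      using degree_pCons_0[of "P * Q"] by (metis univariate_simps(5))
    hence "degree (univariate v Q) = 0" using assms(2) by (simp add: degree_mult_eq)
    thus ?thesis by (rule degree_univariate_eq_0_imp) simp
  qed
  thus ?thesis unfolding polys_def by blast
qed

definition total_degree :: "nat cpoly \<Rightarrow> nat" where
  "total_degree P = degree (homogenize P)"

lemma poly_homogenize_1: "poly (homogenize P) 1 = P"
  by (induction P rule: cpoly_induct) auto

lemma homogenize_eq_0_iff [simp]: "homogenize P = 0 \<longleftrightarrow> P = 0"
  using poly_homogenize_1[of P] by auto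

lemma total_degree_mult: "P \<noteq> 0 \<Longrightarrow> Q \<noteq> 0 \<Longrightarrow> total_degree (P * Q) = total_degree P + total_degree Q"
  by (simp add: total_degree_def degree_mult_eq)

lemma total_degree_Const [simp]: "total_degree (Const c) = 0"
  by (simp add: total_degree_def)

lemma total_degree_0 [simp]: "total_degree 0 = 0"
  by (simp add: total_degree_def)

lemma total_degree_eq_0_imp:
  assumes "total_degree P = 0" shows "\<exists>c. P = Const c"
proof -
  obtain a where a: "homogenize P = [:a:]"
    using assms unfolding total_degree_def by (rule degree_eq_zeroE)
  have "\<exists>c. poly (homogenize P) 0 = Const c"
    by (induction P rule: cpoly_induct) (auto simp flip: Const_add Const_mult)
  thus ?thesis using a poly_homogenize_1[of P] by auto
qed

section \<open>Unique factorization\<close>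

text \<open>The units are the nonzero constants, so a positive total degree says: neither zero nor a unit.\<close>

definition irreducible_in :: "nat set \<Rightarrow> nat cpoly \<Rightarrow> bool" where
  "irreducible_in V b \<longleftrightarrow> b \<in> polys V \<and> total_degree b > 0 \<and>
    (\<forall>g h. b = g * h \<longrightarrow> total_degree g = 0 \<or> total_degree h = 0)"

definition prime_in :: "nat set \<Rightarrow> nat cpoly \<Rightarrow> bool" where
  "prime_in V b \<longleftrightarrow> b \<in> polys V \<and> total_degree b > 0 \<and>
    (\<forall>g\<in>polys V. \<forall>h\<in>polys V. b dvd g * h \<longrightarrow> b dvd g \<or> b dvd h)"

lemma exists_irreducible_factor:
  assumes "P \<in> polys V" "total_degree P > 0"
  shows "\<exists>b. irreducible_in V b \<and> b dvd P"
  using assms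
proof (induction "total_degree P" arbitrary: P rule: less_induct)
  case less
  show ?case
  proof (cases "irreducible_in V P")
    case False
    then obtain g h where gh: "P = g * h" "total_degree g > 0" "total_degree h > 0"
      using less.prems by (auto simp: irreducible_in_def)
    have nz: "P \<noteq> 0" "g \<noteq> 0" "h \<noteq> 0" using gh less.prems by auto
    have "g \<in> polys V" using polys_factor[of h g V] gh nz less.prems by (simp add: mult.commute)
    moreover have "total_degree g < total_degree P" using gh nz by (simp add: total_degree_mult)
    ultimately obtain b where "irreducible_in V b" "b dvd g" using less.hyps gh(2) by blast
    thus ?thesis using gh(1) by auto
  qed auto
qed

text \<open>Gauss's lemma: of the first coefficients of \<open>g\<close> and of \<open>h\<close> that \<open>p\<close> does not divide, the product
  is a coefficient of \<open>g h\<close> modulo \<open>p\<close>.\<close>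

lemma prime_in_insert:
  assumes "prime_in V p" "v \<notin> V" "g \<in> polys (insert v V)" "h \<in> polys (insert v V)"
    and "p dvd g * h"
  shows "p dvd g \<or> p dvd h"
proof (rule ccontr)
  have p: "p \<in> polys V" using assms(1) by (simp add: prime_in_def)
  have dvd_iff: "p dvd P \<longleftrightarrow> (\<forall>k. p dvd coeff (univariate v P) k)" for P
  proof
    assume "p dvd P"
    then obtain q where "P = p * q" ..
    hence "univariate v P = [:p:] * univariate v q" using univariate_constant[OF p assms(2)] by simp
    hence "[:p:] dvd univariate v P" ..
    thus "\<forall>k. p dvd coeff (univariate v P) k" by (simp add: const_poly_dvd_iff)
  next
    assume "\<forall>k. p dvd coeff (univariate v P) k"
    hence "p dvd poly (univariate v P) (Var v)" by (auto simp: poly_altdef intro!: dvd_sum)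
    thus "p dvd P" by (simp add: poly_univariate)
  qed
  let ?g = "coeff (univariate v g)" and ?h = "coeff (univariate v h)"
  assume "\<not> (p dvd g \<or> p dvd h)"
  hence ex: "\<exists>k. \<not> p dvd ?g k" "\<exists>k. \<not> p dvd ?h k" using dvd_iff by blast+
  define i where "i = (LEAST k. \<not> p dvd ?g k)"
  define j where "j = (LEAST k. \<not> p dvd ?h k)"
  have i: "\<not> p dvd ?g i" "\<And>k. k < i \<Longrightarrow> p dvd ?g k"
    unfolding i_def using LeastI_ex[OF ex(1)] not_less_Least by blast+
  have j: "\<not> p dvd ?h j" "\<And>k. k < j \<Longrightarrow> p dvd ?h k"
    unfolding j_def using LeastI_ex[OF ex(2)] not_less_Least by blast+
  have "p dvd coeff (univariate v (g * h)) (i + j)" using assms(5) dvd_iff by blast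
  also have "coeff (univariate v (g * h)) (i + j) = (\<Sum>k\<le>i + j. ?g k * ?h (i + j - k))"
    by (simp add: coeff_mult)
  also have "\<dots> = ?g i * ?h j + (\<Sum>k\<in>{..i + j} - {i}. ?g k * ?h (i + j - k))"
    by (simp add: sum.remove[of _ i])
  finally have "p dvd ?g i * ?h j + (\<Sum>k\<in>{..i + j} - {i}. ?g k * ?h (i + j - k))" .
  moreover have "p dvd (\<Sum>k\<in>{..i + j} - {i}. ?g k * ?h (i + j - k))"
  proof (rule dvd_sum)
    fix k assume "k \<in> {..i + j} - {i}"
    hence "k < i \<or> i + j - k < j" by auto
    thus "p dvd ?g k * ?h (i + j - k)" using i(2) j(2) by auto
  qed
  ultimately have "p dvd ?g i * ?h j" by (simp add: dvd_add_left_iff)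
  moreover have "?g i \<in> polys V" "?h j \<in> polys V"
    using assms(3,4) by (simp_all add: coeff_univariate_in_polys)
  ultimately show False using assms(1) i(1) j(1) unfolding prime_in_def by blast
qed

text \<open>Division with remainder in the variable \<open>v\<close>. The leading coefficient of \<open>r\<close> has no inverse, so
  \<open>f\<close> has to be multiplied by some \<open>c\<close> first.\<close>

lemma pseudo_division:
  assumes "v \<notin> V" "f \<in> polys (insert v V)" "r \<in> polys (insert v V)" "r \<noteq> 0"
  shows "\<exists>c\<in>polys V. \<exists>q\<in>polys (insert v V). \<exists>s\<in>polys (insert v V). c \<noteq> 0 \<and> c * f = q * r + s \<and>
    (s = 0 \<or> degree (univariate v s) < degree (univariate v r))"
  using assms(2)
proof (induction "if f = 0 then 0 else Suc (degree (univariate v f))" arbitrary: f rule: less_induct)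
  case less
  let ?W = "insert v V"
  let ?F = "univariate v f" and ?R = "univariate v r"
  show ?case
  proof (cases "f = 0 \<or> degree ?F < degree ?R")
    case True
    thus ?thesis using less.prems by (intro bexI[of _ 1] bexI[of _ 0] bexI[of _ f]) auto
  next
    case False
    define e where "e = degree ?F - degree ?R"
    define f1 where "f1 = lead_coeff ?R * f - lead_coeff ?F * Var v ^ e * r"
    have lc: "lead_coeff ?R \<in> polys V" "lead_coeff ?F \<in> polys V"
      using assms(3) less.prems by (simp_all add: coeff_univariate_in_polys)
    hence lcW: "lead_coeff ?R \<in> polys ?W" "lead_coeff ?F \<in> polys ?W"
      using polys_mono[of V ?W] by auto
    have f1W: "f1 \<in> polys ?W" unfolding f1_def using lcW less.prems assms(3) by simp
    have F1: "univariate v f1 = smult (lead_coeff ?R) ?F - smult (lead_coeff ?F) (monom 1 e * ?R)"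
      unfolding f1_def using univariate_constant[OF _ assms(1)] lc
      by (simp add: univariate_Var_power mult.assoc)
    have "coeff (univariate v f1) k = 0" if "k \<ge> degree ?F" for k
    proof (cases "k = degree ?F")
      case True
      have "degree ?R \<le> degree ?F" using False by auto
      thus ?thesis unfolding F1 True e_def by (simp add: coeff_monom_mult)
    next
      case k: False
      hence "coeff ?F k = 0" using that by (simp add: coeff_eq_0)
      moreover have "coeff (monom 1 e * ?R) k = 0"
        using k that False by (auto simp: coeff_monom_mult e_def intro: coeff_eq_0)
      ultimately show ?thesis unfolding F1 by simp
    qed
    hence "f1 = 0 \<or> degree (univariate v f1) < degree ?F"
      by (metis leading_coeff_0_iff linorder_not_le univariate_eq_0_iff)
    hence "\<exists>c\<in>polys V. \<exists>q\<in>polys ?W. \<exists>s\<in>polys ?W. c \<noteq> 0 \<and> c * f1 = q * r + s \<and>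
        (s = 0 \<or> degree (univariate v s) < degree (univariate v r))"
      using False by (intro less.hyps f1W) auto
    then obtain c q s where cqs: "c \<in> polys V" "q \<in> polys ?W" "s \<in> polys ?W" "c \<noteq> 0"
      "c * f1 = q * r + s" "s = 0 \<or> degree (univariate v s) < degree ?R" by blast
    have cW: "c \<in> polys ?W" using cqs(1) polys_mono[of V ?W] by auto
    have eq: "(c * lead_coeff ?R) * f = (q + c * lead_coeff ?F * Var v ^ e) * r + s"
      using cqs(5) unfolding f1_def by (simp add: algebra_simps)
    have nz: "c * lead_coeff ?R \<noteq> 0" using cqs(4) assms(4) by simp
    have qW: "q + c * lead_coeff ?F * Var v ^ e \<in> polys ?W" using cqs(2) cW lcW by simp
    show ?thesis
      by (rule bexI[of _ "c * lead_coeff ?R"], rule bexI[OF _ qW], rule bexI[OF _ cqs(3)])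
        (use eq nz cqs(6) cqs(1) lc in auto)
  qed
qed

text \<open>The inductive step towards unique factorization: one more variable \<open>v\<close>, and an irreducible \<open>f\<close>
  that involves it. No prime in the old variables divides such an \<open>f\<close>, so the coefficients
  introduced by pseudo-division can be removed, prime by prime.\<close>

context
  fixes V :: "nat set" and v :: nat and f :: "nat cpoly"
  assumes irreducible_imp_prime: "\<And>b. irreducible_in V b \<Longrightarrow> prime_in V b"
    and v: "v \<notin> V" and f: "irreducible_in (insert v V) f" "degree (univariate v f) > 0"
begin

lemma no_coefficient_divisor: "prime_in V p \<Longrightarrow> \<not> p dvd f"
proof
  assume p: "prime_in V p" "p dvd f"
  then obtain w where w: "f = p * w" by (auto elim: dvdE)
  with f(1) have "total_degree p = 0 \<or> total_degree w = 0" unfolding irreducible_in_def by metis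
  with p(1) have "total_degree w = 0" by (simp add: prime_in_def)
  then obtain c where "w = Const c" using total_degree_eq_0_imp by blast
  hence "f \<in> polys V" using w p(1) by (auto simp: prime_in_def)
  hence "univariate v f = [:f:]" using v by (rule univariate_constant)
  thus False using f(2) by simp
qed

lemma cancel_coefficient:
  assumes "c \<in> polys V" "c \<noteq> 0" "u \<in> polys (insert v V)" "f dvd c * u"
  shows "f dvd u"
  using assms(1,2,4)
proof (induction "total_degree c" arbitrary: c rule: less_induct)
  case less
  show ?case
  proof (cases "u = 0")
    case u: False
    show ?thesis
    proof (cases "total_degree c = 0")
      case True
      then obtain a where a: "c = Const a" using total_degree_eq_0_imp by blast
      hence "u = Const (inverse a) * (c * u)" using less.prems
        by (simp add: mult.assoc[symmetric] Const_mult[symmetric])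
      thus ?thesis using less.prems(3) by (metis dvd_mult)
    next
      case False
      then obtain p where "irreducible_in V p" "p dvd c"
        using exists_irreducible_factor[OF less.prems(1)] by auto
      then obtain c' where p: "prime_in V p" and c': "c = p * c'"
        using irreducible_imp_prime by (auto elim: dvdE)
      have nz: "p \<noteq> 0" "c' \<noteq> 0" using c' less.prems by auto
      have c'V: "c' \<in> polys V" using polys_factor less.prems c' by blast
      obtain k where k: "c * u = f * k" using less.prems(3) by (auto elim: dvdE)
      have "c * u \<in> polys (insert v V)"
        using subsetD[OF polys_mono[OF subset_insertI] less.prems(1)] assms(3) by (rule polys_mult)
      hence kW: "k \<in> polys (insert v V)"
        using polys_factor[of f k] k u less.prems(2) by (metis mult_eq_0_iff)
      have "p dvd f * k" using k c' by (metis dvd_triv_left mult.assoc)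
      hence "p dvd k"
        using prime_in_insert[OF p v _ kW] no_coefficient_divisor[OF p] f(1)
        by (auto simp: irreducible_in_def)
      then obtain k' where "k = p * k'" by (auto elim: dvdE)
      hence "c' * u = f * k'" using k c' nz by (simp add: mult.left_commute mult.assoc)
      moreover have "total_degree c' < total_degree c"
        using c' nz p by (simp add: total_degree_mult prime_in_def)
      ultimately show ?thesis using less.hyps c'V nz by auto
    qed
  qed simp
qed

lemma factor_over_coefficients:
  assumes "c \<in> polys V" "c \<noteq> 0" "q \<in> polys (insert v V)" "r \<in> polys (insert v V)" "c * f = q * r"
  shows "\<exists>q' r' d. f = q' * r' \<and> r = d * r' \<and> d \<in> polys V"
  using assms
proof (induction "total_degree c" arbitrary: c q r rule: less_induct)
  case less
  have f0: "f \<noteq> 0" using f by auto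
  show ?case
  proof (cases "total_degree c = 0")
    case True
    then obtain a where a: "c = Const a" using total_degree_eq_0_imp by blast
    hence "f = Const (inverse a) * (c * f)" using less.prems(2)
      by (simp add: mult.assoc[symmetric] Const_mult[symmetric])
    also have "\<dots> = (Const (inverse a) * q) * r" by (simp only: less.prems(5) mult.assoc)
    finally have "f = (Const (inverse a) * q) * r" .
    moreover have "r = 1 * r" by simp
    ultimately show ?thesis using polys_1 by blast
  next
    case False
    then obtain p where "irreducible_in V p" "p dvd c"
      using exists_irreducible_factor[OF less.prems(1)] by auto
    then obtain c' where p: "prime_in V p" and c': "c = p * c'"
      using irreducible_imp_prime by (auto elim: dvdE)
    have nz: "p \<noteq> 0" "c' \<noteq> 0" using c' less.prems by auto
    have c'V: "c' \<in> polys V" using polys_factor less.prems c' by blast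
    have deg: "total_degree c' < total_degree c"
      using c' nz p by (simp add: total_degree_mult prime_in_def)
    have qr0: "q \<noteq> 0" "r \<noteq> 0" using less.prems f0 by auto
    have "p dvd q * r" using less.prems(5) c' by (metis dvd_triv_left mult.assoc)
    hence "p dvd q \<or> p dvd r" using prime_in_insert[OF p v] less.prems by blast
    thus ?thesis
    proof
      assume "p dvd q"
      then obtain q1 where q1: "q = p * q1" by (auto elim: dvdE)
      have "c' * f = q1 * r" using less.prems(5) q1 c' nz by (simp add: mult.assoc)
      moreover have "q1 \<in> polys (insert v V)" using polys_factor q1 qr0 less.prems(3) by blast
      ultimately show ?thesis using less.hyps[OF deg c'V nz(2)] less.prems(4) by blast
    next
      assume "p dvd r"
      then obtain r1 where r1: "r = p * r1" by (auto elim: dvdE)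
      have "c' * f = q * r1" using less.prems(5) r1 c' nz by (simp add: ac_simps)
      moreover have "r1 \<in> polys (insert v V)" using polys_factor r1 qr0 less.prems(4) by blast
      ultimately obtain q' r' d where "f = q' * r'" "r1 = d * r'" "d \<in> polys V"
        using less.hyps[OF deg c'V nz(2)] less.prems(3) by blast
      thus ?thesis using r1 p unfolding prime_in_def
        by (intro exI[of _ q'] exI[of _ r'] exI[of _ "p * d"]) (auto simp: mult.assoc)
    qed
  qed
qed

text \<open>Let \<open>f\<close> divide \<open>g h\<close>, and take a nonzero element \<open>r\<close> of least degree in the ideal of \<open>f\<close> and \<open>g\<close>.
  By pseudo-division it divides \<open>f\<close> and \<open>g\<close> up to coefficients. If \<open>r\<close> is itself a coefficient
  then \<open>f\<close> divides \<open>h\<close>; otherwise \<open>r\<close> is \<open>f\<close> up to coefficients, and \<open>f\<close> divides \<open>g\<close>.\<close>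

lemma irreducible_imp_prime_step: "prime_in (insert v V) f"
proof -
  let ?W = "insert v V"
  have fW: "f \<in> polys ?W" and f0: "f \<noteq> 0" using f by (auto simp: irreducible_in_def)
  have VW: "c \<in> polys ?W" if "c \<in> polys V" for c using that polys_mono[of V ?W] by auto
  have "f dvd g \<or> f dvd h" if g: "g \<in> polys ?W" and h: "h \<in> polys ?W" and gh: "f dvd g * h" for g h
  proof -
    define I where "I = {u * f + w * g |u w. u \<in> polys ?W \<and> w \<in> polys ?W}"
    have "f = 1 * f + 0 * g" by simp
    hence "f \<in> I - {0}" using f0 polys_0 polys_1 unfolding I_def by blast
    then obtain r where r: "r \<in> I - {0}"
        "\<And>s. s \<in> I - {0} \<Longrightarrow> degree (univariate v r) \<le> degree (univariate v s)"
      using ex_has_least_nat[of "\<lambda>r. r \<in> I - {0}" f "\<lambda>r. degree (univariate v r)"] by blast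
    then obtain u w where uw: "r = u * f + w * g" "u \<in> polys ?W" "w \<in> polys ?W"
      by (auto simp: I_def)
    have rW: "r \<in> polys ?W" using uw fW g by simp
    have div: "\<exists>c\<in>polys V. \<exists>q\<in>polys ?W. c \<noteq> 0 \<and> c * k = q * r"
      if k: "k \<in> polys ?W" "k = f \<or> k = g" for k
    proof -
      obtain c q s where cqs: "c \<in> polys V" "q \<in> polys ?W" "s \<in> polys ?W" "c \<noteq> 0"
        "c * k = q * r + s" "s = 0 \<or> degree (univariate v s) < degree (univariate v r)"
        using pseudo_division[OF v k(1) rW] r(1) by blast
      have "s \<in> I"
      proof (cases "k = f")
        case True
        have "s = (c - q * u) * f + (- (q * w)) * g"
          using cqs(5) uw(1) True by (simp add: algebra_simps)
        moreover have "c - q * u \<in> polys ?W" "- (q * w) \<in> polys ?W" using cqs VW uw by auto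
        ultimately show ?thesis unfolding I_def by blast
      next
        case False
        hence "k = g" using k(2) by simp
        have "s = (- (q * u)) * f + (c - q * w) * g"
          using cqs(5) uw(1) \<open>k = g\<close> by (simp add: algebra_simps)
        moreover have "c - q * w \<in> polys ?W" "- (q * u) \<in> polys ?W" using cqs VW uw by auto
        ultimately show ?thesis unfolding I_def by blast
      qed
      hence "s = 0" using r(2)[of s] cqs(6) by force
      thus ?thesis using cqs by auto
    qed
    obtain c q where cq: "c \<in> polys V" "q \<in> polys ?W" "c \<noteq> 0" "c * f = q * r"
      using div[OF fW] by blast
    obtain c2 q2 where cq2: "c2 \<in> polys V" "q2 \<in> polys ?W" "c2 \<noteq> 0" "c2 * g = q2 * r"
      using div[OF g] by blast
    obtain q' r' d where fac: "f = q' * r'" "r = d * r'" "d \<in> polys V"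
      using factor_over_coefficients[OF cq(1,3,2) rW cq(4)] by blast
    show ?thesis
    proof (cases "total_degree q' = 0")
      case True
      then obtain a where a: "q' = Const a" using total_degree_eq_0_imp by blast
      hence "a \<noteq> 0" using fac(1) f0 by auto
      hence "r' = Const (inverse a) * f"
        using fac(1) a by (simp add: mult.assoc[symmetric] Const_mult[symmetric])
      hence "f dvd c2 * g" using cq2(4) fac(2) by simp
      thus ?thesis using cancel_coefficient[OF cq2(1,3) g] by blast
    next
      case False
      hence "total_degree r' = 0" using f(1) fac(1) unfolding irreducible_in_def by metis
      then obtain a where "r' = Const a" using total_degree_eq_0_imp by blast
      hence rV: "r \<in> polys V" using fac by simp
      have "r * h = f * (u * h) + w * (g * h)" using uw(1) by (simp add: algebra_simps)
      hence "f dvd r * h" using gh by simp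
      thus ?thesis using cancel_coefficient[OF rV _ h] r(1) by blast
    qed
  qed
  thus ?thesis using f fW by (auto simp: prime_in_def irreducible_in_def)
qed

end

theorem irreducible_in_imp_prime_in:
  assumes "finite V" "irreducible_in V b" shows "prime_in V b"
  using assms
proof (induction V arbitrary: b rule: finite_induct)
  case empty
  have b: "b \<in> polys {}" "total_degree b > 0" using empty by (simp_all add: irreducible_in_def)
  from b(1) have "\<exists>c. b = Const c"
    by (induction b rule: polys_induct) (auto simp flip: Const_add Const_mult)
  thus ?case using b(2) by auto
next
  case (insert v V)
  show ?case
  proof (cases "degree (univariate v b) > 0")
    case True
    show ?thesis by (rule irreducible_imp_prime_step[OF insert.IH insert.hyps(2) insert.prems True])
  next
    case False
    have bW: "b \<in> polys (insert v V)" using insert.prems by (simp add: irreducible_in_def)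
    have bV: "b \<in> polys V" using degree_univariate_eq_0_imp[OF _ bW] False by simp
    hence "prime_in V b" using insert.IH insert.prems by (simp add: irreducible_in_def)
    thus ?thesis
      using prime_in_insert[OF _ insert.hyps(2)] bW by (auto simp: prime_in_def)
  qed
qed

section \<open>Algebraic dependence by counting\<close>

text \<open>Gaussian elimination, one equation at a time.\<close>

lemma underdetermined_system:
  fixes a :: "'i \<Rightarrow> 'j \<Rightarrow> 'k::field"
  assumes "finite I" "finite J" "card I < card J"
  shows "\<exists>x. (\<exists>j\<in>J. x j \<noteq> 0) \<and> (\<forall>i\<in>I. (\<Sum>j\<in>J. a i j * x j) = 0)"
  using assms
proof (induction I arbitrary: J a rule: finite_induct)
  case empty
  hence "J \<noteq> {}" by auto
  thus ?case by (intro exI[of _ "\<lambda>_. 1"]) auto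
next
  case (insert i I)
  show ?case
  proof (cases "\<forall>j\<in>J. a i j = 0")
    case True
    obtain x where "\<exists>j\<in>J. x j \<noteq> 0" "\<forall>i\<in>I. (\<Sum>j\<in>J. a i j * x j) = 0"
      using insert.IH[of J a] insert.prems insert.hyps by auto
    with True show ?thesis by (intro exI[of _ x]) auto
  next
    case False
    then obtain j0 where j0: "j0 \<in> J" "a i j0 \<noteq> 0" by blast
    define J' where "J' = J - {j0}"
    have J': "finite J'" "card I < card J'" "J = insert j0 J'" "j0 \<notin> J'"
      using insert.prems insert.hyps j0 by (auto simp: J'_def)
    obtain x where x: "\<exists>j\<in>J'. x j \<noteq> 0"
      "\<forall>k\<in>I. (\<Sum>j\<in>J'. (a k j - a k j0 * a i j / a i j0) * x j) = 0"
      using insert.IH[OF J'(1,2), of "\<lambda>k j. a k j - a k j0 * a i j / a i j0"] by auto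
    define y where "y = x(j0 := - (\<Sum>j\<in>J'. a i j * x j) / a i j0)"
    have split: "(\<Sum>j\<in>J. a k j * y j) = a k j0 * y j0 + (\<Sum>j\<in>J'. a k j * x j)" for k
    proof -
      have "(\<Sum>j\<in>J'. a k j * y j) = (\<Sum>j\<in>J'. a k j * x j)"
        using J'(4) by (intro sum.cong) (auto simp: y_def)
      thus ?thesis using J' by simp
    qed
    have "(\<Sum>j\<in>J. a k j * y j) = 0" if k: "k \<in> insert i I" for k
    proof (cases "k = i")
      case True
      thus ?thesis unfolding split True using j0(2) by (simp add: y_def)
    next
      case False
      hence "0 = (\<Sum>j\<in>J'. (a k j - a k j0 * a i j / a i j0) * x j)" using x(2) k by auto
      also have "\<dots> = (\<Sum>j\<in>J'. a k j * x j) - a k j0 / a i j0 * (\<Sum>j\<in>J'. a i j * x j)"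
        by (simp add: left_diff_distrib sum_subtractf sum_distrib_left mult.assoc)
      finally show ?thesis unfolding split by (simp add: y_def)
    qed
    moreover have "\<exists>j\<in>J. y j \<noteq> 0" using x(1) J'(3,4) by (auto simp: y_def)
    ultimately show ?thesis by blast
  qed
qed

definition exponent_box :: "'v set \<Rightarrow> nat \<Rightarrow> ('v \<Rightarrow>\<^sub>0 nat) set" where
  "exponent_box V d = {m. Poly_Mapping.keys m \<subseteq> V \<and> (\<forall>v\<in>V. Poly_Mapping.lookup m v < d)}"

lemma card_exponent_box:
  assumes "finite V" shows "finite (exponent_box V d) \<and> card (exponent_box V d) = d ^ card V"
  using assms
proof (induction V rule: finite_induct)
  case empty
  have "exponent_box {} d = ({0} :: ('a \<Rightarrow>\<^sub>0 nat) set)" by (auto simp: exponent_box_def)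
  thus ?case by simp
next
  case (insert v V)
  let ?f = "\<lambda>(m :: 'a \<Rightarrow>\<^sub>0 nat, k). m + Poly_Mapping.single v k"
  have out: "Poly_Mapping.lookup m v = 0" if "m \<in> exponent_box V d" for m
    using that insert.hyps(2) by (auto simp: exponent_box_def in_keys_iff)
  have inj: "inj_on ?f (exponent_box V d \<times> {..<d})"
  proof (rule inj_onI, clarify)
    fix m k m' k' assume mm: "m \<in> exponent_box V d" "m' \<in> exponent_box V d"
      and eq: "m + Poly_Mapping.single v k = m' + Poly_Mapping.single v k'"
    have "Poly_Mapping.lookup (m + Poly_Mapping.single v k) v = Poly_Mapping.lookup (m' + Poly_Mapping.single v k') v"
      using eq by simp
    hence "k = k'" using out mm by (simp add: lookup_add)
    thus "m = m' \<and> k = k'" using eq by simp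
  qed
  have "exponent_box (insert v V) d = ?f ` (exponent_box V d \<times> {..<d})"
  proof (intro equalityI subsetI)
    fix m assume m: "m \<in> exponent_box (insert v V) d"
    define k where "k = Poly_Mapping.lookup m v"
    define m' where "m' = m - Poly_Mapping.single v k"
    have l: "Poly_Mapping.lookup m' i = (if i = v then 0 else Poly_Mapping.lookup m i)" for i
      by (simp add: m'_def k_def lookup_minus lookup_single when_def)
    have "m = m' + Poly_Mapping.single v k"
      by (rule poly_mapping_eqI) (simp add: lookup_add l lookup_single when_def k_def)
    moreover have "x \<in> V" if "x \<in> Poly_Mapping.keys m'" for x
    proof -
      have "x \<noteq> v" "x \<in> Poly_Mapping.keys m" using that l[of x] by (auto simp: in_keys_iff split: if_splits)
      thus ?thesis using m by (auto simp: exponent_box_def)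
    qed
    hence "m' \<in> exponent_box V d" "k < d"
      using m by (auto simp: exponent_box_def l k_def)
    ultimately show "m \<in> ?f ` (exponent_box V d \<times> {..<d})" by force
  next
    fix m assume "m \<in> ?f ` (exponent_box V d \<times> {..<d})"
    then obtain m' k where "m = m' + Poly_Mapping.single v k" "m' \<in> exponent_box V d" "k < d" by auto
    thus "m \<in> exponent_box (insert v V) d"
      using keys_add[of m' "Poly_Mapping.single v k"] out[of m'] insert.hyps
      by (auto simp: exponent_box_def lookup_add lookup_single when_def split: if_splits)
  qed
  thus ?case using insert inj by (simp add: card_image card_cartesian_product)
qed

lemma var_degree_le_mono: "var_degree_le v P d \<Longrightarrow> d \<le> d' \<Longrightarrow> var_degree_le v P d'"
  unfolding var_degree_le_def by fastforce

lemma var_degree_le_mult: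
  "var_degree_le v P d \<Longrightarrow> var_degree_le v Q e \<Longrightarrow> var_degree_le v (P * Q) (d + e)"
  unfolding var_degree_le_def using keys_mult[of P Q] by (fastforce simp: lookup_add intro: add_mono)

lemma var_degree_le_1: "var_degree_le v 1 d"
  by (simp add: var_degree_le_def)

lemma var_degree_le_power: "var_degree_le v P d \<Longrightarrow> var_degree_le v (P ^ k) (k * d)"
  by (induction k) (auto simp: var_degree_le_1 intro: var_degree_le_mult)

lemma var_degree_le_prod:
  "(\<And>i. i \<in> I \<Longrightarrow> var_degree_le v (F i) (d i)) \<Longrightarrow> var_degree_le v (prod F I) (sum d I)"
  by (induction I rule: infinite_finite_induct) (auto simp: var_degree_le_1 intro: var_degree_le_mult)

lemma degree_bound_exists: "\<exists>d. \<forall>v. var_degree_le v P d"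
proof (intro exI allI)
  fix v
  let ?s = "\<lambda>m. \<Sum>i\<in>Poly_Mapping.keys m. Poly_Mapping.lookup m i"
  show "var_degree_le v P (\<Sum>m\<in>Poly_Mapping.keys P. ?s m)"
    unfolding var_degree_le_def
  proof
    fix m assume m: "m \<in> Poly_Mapping.keys P"
    have "Poly_Mapping.lookup m v \<le> ?s m"
      by (cases "v \<in> Poly_Mapping.keys m") (auto simp: in_keys_iff intro: member_le_sum)
    also have "\<dots> \<le> (\<Sum>m\<in>Poly_Mapping.keys P. ?s m)" using m by (intro member_le_sum) auto
    finally show "Poly_Mapping.lookup m v \<le> (\<Sum>m\<in>Poly_Mapping.keys P. ?s m)" .
  qed
qed

lemma keys_subset_exponent_box:
  assumes "P \<in> polys V" "\<And>v. var_degree_le v P d" "d < d'"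
  shows "Poly_Mapping.keys P \<subseteq> exponent_box V d'"
proof
  fix m assume m: "m \<in> Poly_Mapping.keys P"
  have "Poly_Mapping.lookup m v < d'" for v
    using assms(2)[of v] assms(3) m by (auto simp: var_degree_le_def intro: le_less_trans)
  thus "m \<in> exponent_box V d'" using m assms(1) by (auto simp: polys_def exponent_box_def)
qed

lemma lookup_Const_mult: "Poly_Mapping.lookup (Const c * P) m = c * Poly_Mapping.lookup P m"
proof -
  have "Const c * P = Const c * (\<Sum>l\<in>Poly_Mapping.keys P. Poly_Mapping.single l (Poly_Mapping.lookup P l))"
    by (simp only: sum_of_monomials[symmetric])
  also have "\<dots> = (\<Sum>l\<in>Poly_Mapping.keys P. Poly_Mapping.single l (c * Poly_Mapping.lookup P l))"
    by (simp add: sum_distrib_left Const_def mult_single)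
  finally show ?thesis by (auto simp: lookup_sum lookup_single when_def in_keys_iff)
qed

lemma single_eq_Const_mult: "Poly_Mapping.single m c = Const c * Poly_Mapping.single m 1"
  by (simp add: Const_def mult_single)

lemma lookup_sum_singles:
  "finite B \<Longrightarrow> m \<in> B \<Longrightarrow> Poly_Mapping.lookup (\<Sum>l\<in>B. Poly_Mapping.single l (x l)) m = x m"
  by (simp add: lookup_sum lookup_single when_def)

lemma power_add_le: "(M + e) ^ n \<le> M ^ n + n * e * (M + e) ^ (n - 1)" for M e n :: nat
proof (induction n)
  case (Suc n)
  have "(M + e) ^ Suc n = M * (M + e) ^ n + e * (M + e) ^ n" by (simp add: algebra_simps)
  also have "M * (M + e) ^ n \<le> M * (M ^ n + n * e * (M + e) ^ (n - 1))"
    using Suc by (rule mult_left_mono) simp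
  also have "\<dots> = M ^ Suc n + n * e * (M * (M + e) ^ (n - 1))" by (simp add: algebra_simps)
  also have "n * e * (M * (M + e) ^ (n - 1)) \<le> n * e * (M + e) ^ n"
    by (cases n) (auto intro!: mult_left_mono mult_right_mono)
  finally show ?case by (simp add: algebra_simps)
qed simp

text \<open>A dimension count that replaces transcendence degrees. With \<open>n = card W\<close>, the polynomials \<open>Q\<close> in
  \<open>n\<close> variables of degree less than \<open>d\<close> in each of them form a space of dimension \<open>d\<^sup>n\<close>. Their values
  at \<open>u\<close> have degrees of order \<open>d\<close>, and modulo the multiples of \<open>b\<close> these span a space
  of dimension only of order \<open>d\<^bsup>n-1\<^esup>\<close>. So for large \<open>d\<close> the linear system \<open>Q(u) = b q\<close> has more unknown
  coefficients than equations.\<close>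

lemma algebraically_dependent_modulo:
  fixes u :: "nat \<Rightarrow> nat cpoly"
  assumes "finite V" "finite W" "card W \<le> card V"
    and b: "b \<in> polys W" "b \<noteq> 0" and u: "\<And>i. i \<in> V \<Longrightarrow> u i \<in> polys W"
  shows "\<exists>Q\<in>polys V. Q \<noteq> 0 \<and> b dvd subst u Q"
proof -
  define n where "n = card W"
  obtain V' where V': "V' \<subseteq> V" "card V' = n" "finite V'"
    using obtain_subset_with_card_n[OF assms(3)] assms(1) finite_subset n_def by metis
  have "\<forall>i. \<exists>d. \<forall>v. var_degree_le v (u i) d" using degree_bound_exists by blast
  then obtain du where du: "\<And>i v. var_degree_le v (u i) (du i)" by metis
  define D where "D = (\<Sum>i\<in>V'. du i)"
  have D: "var_degree_le v (u i) D" if "i \<in> V'" for i v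
    using du that V'(3) unfolding D_def by (meson member_le_sum var_degree_le_mono zero_le)
  obtain e where e: "\<And>v. var_degree_le v b e" using degree_bound_exists by blast
  \<comment> \<open>\<open>K\<close> is chosen so that \<open>M + e \<le> d K\<close>, and \<open>M\<close> exceeds the degrees of the \<open>Q(u)\<close>.\<close>
  define K where "K = n * D + 1 + e"
  define d where "d = n * e * K ^ (n - 1) + 1"
  define M where "M = n * (D * d) + 1"
  have count: "(M + e) ^ n < d ^ n + M ^ n"
  proof (cases n)
    case (Suc n')
    have "M + e \<le> d * K"
    proof -
      have "1 + e \<le> d * (1 + e)" by (simp add: d_def)
      thus ?thesis unfolding M_def K_def by (simp add: algebra_simps)
    qed
    hence "n * e * (M + e) ^ (n - 1) \<le> n * e * (d * K) ^ (n - 1)"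
      by (intro mult_left_mono power_mono) auto
    also have "\<dots> = (n * e * K ^ (n - 1)) * d ^ (n - 1)" by (simp add: power_mult_distrib)
    also have "\<dots> < d * d ^ (n - 1)" by (intro mult_strict_right_mono) (auto simp: d_def)
    also have "\<dots> = d ^ n" using Suc by simp
    finally show ?thesis using power_add_le[of M e n] by simp
  qed simp
  let ?B1 = "exponent_box V' d" and ?B2 = "exponent_box W M" and ?B3 = "exponent_box W (M + e)"
  define g where "g m = subst u (Poly_Mapping.single m 1)" for m
  define h where "h m = b * Poly_Mapping.single m 1" for m
  have fin: "finite ?B1" "finite ?B2" "finite ?B3"
    and card: "card ?B1 = d ^ n" "card ?B2 = M ^ n" "card ?B3 = (M + e) ^ n"
    using card_exponent_box[OF V'(3)] card_exponent_box[OF assms(2)] V'(2) n_def by auto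
  have g: "Poly_Mapping.keys (g m) \<subseteq> ?B3" if m: "m \<in> ?B1" for m
  proof (rule keys_subset_exponent_box)
    have keys: "Poly_Mapping.keys m \<subseteq> V'" and lt: "\<And>i. i \<in> V' \<Longrightarrow> Poly_Mapping.lookup m i < d"
      using m by (auto simp: exponent_box_def)
    have eq: "g m = (\<Prod>i\<in>Poly_Mapping.keys m. u i ^ Poly_Mapping.lookup m i)"
      by (simp add: g_def subst_def eval_hom_single[OF coefficient_hom_Const])
    show "g m \<in> polys W" unfolding eq using keys V' u by (intro polys_prod polys_power) auto
    fix v
    have "var_degree_le v (g m) (\<Sum>i\<in>Poly_Mapping.keys m. Poly_Mapping.lookup m i * D)"
      unfolding eq using keys D by (intro var_degree_le_prod var_degree_le_power) auto
    moreover have "(\<Sum>i\<in>Poly_Mapping.keys m. Poly_Mapping.lookup m i * D) \<le> (\<Sum>i\<in>V'. D * d)"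
    proof (rule order.trans)
      show "(\<Sum>i\<in>Poly_Mapping.keys m. Poly_Mapping.lookup m i * D) \<le> (\<Sum>i\<in>V'. Poly_Mapping.lookup m i * D)"
        using keys V'(3) by (intro sum_mono2) auto
      show "(\<Sum>i\<in>V'. Poly_Mapping.lookup m i * D) \<le> (\<Sum>i\<in>V'. D * d)"
        using lt by (intro sum_mono) (simp add: less_imp_le mult.commute)
    qed
    ultimately show "var_degree_le v (g m) (n * (D * d))"
      using V' by (auto intro: var_degree_le_mono)
    show "n * (D * d) < M + e" by (simp add: M_def)
  qed
  have h: "Poly_Mapping.keys (h m) \<subseteq> ?B3" if m: "m \<in> ?B2" for m
  proof (rule keys_subset_exponent_box)
    show "h m \<in> polys W" unfolding h_def using b(1) m
      by (intro polys_mult) (auto simp: polys_def exponent_box_def)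
    fix v
    have "Poly_Mapping.lookup m v \<le> M - 1"
    proof (cases "v \<in> Poly_Mapping.keys m")
      case True
      thus ?thesis using m by (auto simp: exponent_box_def M_def less_Suc_eq_le)
    qed (simp add: in_keys_iff)
    hence "var_degree_le v (Poly_Mapping.single m 1) (M - 1)" by (simp add: var_degree_le_def)
    from var_degree_le_mult[OF e this] show "var_degree_le v (h m) (e + (M - 1))"
      by (simp add: h_def)
    show "e + (M - 1) < M + e" by (simp add: M_def)
  qed
  define a where "a i j = (case j of Inl m \<Rightarrow> Poly_Mapping.lookup (g m) i
    | Inr m \<Rightarrow> - Poly_Mapping.lookup (h m) i)" for i j
  have "card ?B3 < card (?B1 <+> ?B2)" using count card fin by (simp add: card_Plus)
  then obtain x where x: "\<exists>j\<in>?B1 <+> ?B2. x j \<noteq> 0" "\<And>i. i \<in> ?B3 \<Longrightarrow> (\<Sum>j\<in>?B1 <+> ?B2. a i j * x j) = 0"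
    using underdetermined_system[of ?B3 "?B1 <+> ?B2" a] fin by auto
  define Q where "Q = (\<Sum>m\<in>?B1. Poly_Mapping.single m (x (Inl m)))"
  define q where "q = (\<Sum>m\<in>?B2. Poly_Mapping.single m (x (Inr m)))"
  have sQ: "subst u Q = (\<Sum>m\<in>?B1. Const (x (Inl m)) * g m)"
    unfolding Q_def g_def by (subst single_eq_Const_mult) simp
  have bq: "b * q = (\<Sum>m\<in>?B2. Const (x (Inr m)) * h m)"
    unfolding q_def h_def by (subst single_eq_Const_mult) (simp add: sum_distrib_left mult.left_commute)
  have "subst u Q - b * q = 0"
  proof (rule poly_mapping_eqI)
    fix i
    have l: "Poly_Mapping.lookup (subst u Q - b * q) i =
        (\<Sum>m\<in>?B1. x (Inl m) * Poly_Mapping.lookup (g m) i) - (\<Sum>m\<in>?B2. x (Inr m) * Poly_Mapping.lookup (h m) i)"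
      unfolding sQ bq by (simp add: lookup_minus lookup_sum lookup_Const_mult)
    show "Poly_Mapping.lookup (subst u Q - b * q) i = Poly_Mapping.lookup 0 i"
    proof (cases "i \<in> ?B3")
      case True
      have "(\<Sum>j\<in>?B1 <+> ?B2. a i j * x j) = Poly_Mapping.lookup (subst u Q - b * q) i"
        unfolding l using fin by (simp add: sum.Plus a_def mult.commute sum_negf)
      with x(2)[OF True] show ?thesis by simp
    next
      case False
      hence "m \<in> ?B1 \<Longrightarrow> Poly_Mapping.lookup (g m) i = 0" "m \<in> ?B2 \<Longrightarrow> Poly_Mapping.lookup (h m) i = 0" for m
        using g h by (auto simp: in_keys_iff subset_iff)
      thus ?thesis unfolding l by simp
    qed
  qed
  hence eq: "subst u Q = b * q" by simp
  have "Q \<noteq> 0"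
  proof
    assume Q: "Q = 0"
    hence q: "q = 0" using eq b(2) by simp
    have "x (Inl m) = 0" if "m \<in> ?B1" for m
      using lookup_sum_singles[OF fin(1) that, of "\<lambda>m. x (Inl m)"] Q Q_def by simp
    moreover have "x (Inr m) = 0" if "m \<in> ?B2" for m
      using lookup_sum_singles[OF fin(2) that, of "\<lambda>m. x (Inr m)"] q q_def by simp
    ultimately show False using x(1) by auto
  qed
  moreover have "Q \<in> polys V"
    unfolding Q_def using V'(1) by (intro polys_sum) (auto simp: polys_def exponent_box_def)
  ultimately show ?thesis using eq by auto
qed

section \<open>Determinants given by their entries\<close>

text \<open>Determinants as functions of the entries, so that replacing a row is a case distinction in the
  entries.\<close>

definition entries_det :: "nat \<Rightarrow> (nat \<Rightarrow> nat \<Rightarrow> 'a::comm_ring_1) \<Rightarrow> 'a" where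
  "entries_det n F = det (mat n n (\<lambda>(i, j). F i j))"

lemma entries_det_altdef:
  "entries_det n F = (\<Sum>\<pi> | \<pi> permutes {0..<n}. signof \<pi> * (\<Prod>i=0..<n. F i (\<pi> i)))"
proof -
  have "(\<Prod>i=0..<n. mat n n (\<lambda>(i, j). F i j) $$ (i, \<pi> i)) = (\<Prod>i=0..<n. F i (\<pi> i))"
    if "\<pi> permutes {0..<n}" for \<pi>
    using that by (intro prod.cong refl) (auto dest: permutes_in_image)
  thus ?thesis by (simp add: entries_det_def det_def'[of _ n])
qed

lemma entries_det_cong:
  "(\<And>i j. i < n \<Longrightarrow> j < n \<Longrightarrow> F i j = G i j) \<Longrightarrow> entries_det n F = entries_det n G"
  unfolding entries_det_def by (intro arg_cong[of _ _ det] eq_matI) auto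

lemma entries_det_transpose: "entries_det n (\<lambda>i j. F j i) = entries_det n F"
proof -
  have "mat n n (\<lambda>(i, j). F j i) = transpose_mat (mat n n (\<lambda>(i, j). F i j))"
    by (intro eq_matI) auto
  thus ?thesis unfolding entries_det_def using det_transpose[of "mat n n (\<lambda>(i, j). F i j)" n] by simp
qed

lemma entries_det_mult:
  "entries_det n (\<lambda>i j. \<Sum>k<n. F i k * G k j) = entries_det n F * entries_det n G"
proof -
  have "mat n n (\<lambda>(i, j). \<Sum>k<n. F i k * G k j) = mat n n (\<lambda>(i, j). F i j) * mat n n (\<lambda>(i, j). G i j)"
    by (intro eq_matI) (auto simp: scalar_prod_def atLeast0LessThan)
  thus ?thesis unfolding entries_det_def by (simp add: det_mult[of _ n])
qed

lemma entries_det_diagonal: "entries_det n (\<lambda>i j. if i = j then w i else 0) = (\<Prod>i<n. w i)"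
proof -
  have "entries_det n (\<lambda>i j. if i = j then w i else 0) =
      prod_list (diag_mat (mat n n (\<lambda>(i, j). if i = j then w i else 0)))"
    unfolding entries_det_def by (rule det_upper_triangular) (auto intro!: upper_triangularI)
  also have "\<dots> = (\<Prod>i<n. w i)" by (simp add: prod_list_diag_prod atLeast0LessThan)
  finally show ?thesis .
qed

lemma entries_det_in_polys:
  assumes "\<And>i j. i < n \<Longrightarrow> j < n \<Longrightarrow> F i j \<in> polys V" shows "entries_det n F \<in> polys V"
proof -
  have "signof \<pi> \<in> polys V" for \<pi> :: "nat \<Rightarrow> nat" by (cases \<pi> rule: sign_cases) auto
  thus ?thesis unfolding entries_det_altdef
    by (intro polys_sum polys_mult polys_prod assms) (auto dest: permutes_in_image)
qed

lemma dvd_entries_det_diff: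
  assumes "\<And>i j. i < n \<Longrightarrow> j < n \<Longrightarrow> b dvd F i j - G i j"
  shows "b dvd entries_det n F - entries_det n G"
proof -
  have pr: "b dvd (\<Prod>i\<in>I. x i) - (\<Prod>i\<in>I. y i)" if "\<And>i. i \<in> I \<Longrightarrow> b dvd x i - y i"
    for I :: "nat set" and x y
    using that
  proof (induction I rule: infinite_finite_induct)
    case (insert i I)
    have "x i * prod x I - y i * prod y I = (x i - y i) * prod x I + y i * (prod x I - prod y I)"
      by (simp add: algebra_simps)
    thus ?case using insert by simp
  qed auto
  have "entries_det n F - entries_det n G = (\<Sum>\<pi> | \<pi> permutes {0..<n}.
      signof \<pi> * ((\<Prod>i=0..<n. F i (\<pi> i)) - (\<Prod>i=0..<n. G i (\<pi> i))))"
    unfolding entries_det_altdef by (simp add: sum_subtractf right_diff_distrib)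
  also have "b dvd \<dots>"
    by (intro dvd_sum dvd_mult pr assms) (auto dest: permutes_in_image)
  finally show ?thesis .
qed

definition entries_cofactor :: "nat \<Rightarrow> (nat \<Rightarrow> nat \<Rightarrow> 'a::comm_ring_1) \<Rightarrow> nat \<Rightarrow> nat \<Rightarrow> 'a" where
  "entries_cofactor n F i j = cofactor (mat n n (\<lambda>(i, j). F i j)) i j"

lemma entries_det_replace_row:
  assumes "j < n"
  shows "entries_det n (\<lambda>i k. if i = j then r k else F i k) = (\<Sum>k<n. r k * entries_cofactor n F j k)"
proof -
  let ?A = "mat n n (\<lambda>(i, j). F i j)" and ?B = "mat n n (\<lambda>(i, k). if i = j then r k else F i k)"
  have "cofactor ?B j k = cofactor ?A j k" if "k < n" for k
  proof -
    have "mat_delete ?B j k = mat_delete ?A j k"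
      using assms that unfolding mat_delete_def by (intro eq_matI) auto
    thus ?thesis by (simp add: cofactor_def)
  qed
  thus ?thesis
    unfolding entries_det_def entries_cofactor_def
    using laplace_expansion_row[of ?B n j] assms by simp
qed

lemma entries_cofactor_orthogonal:
  assumes "k < n" "l < n"
  shows "(\<Sum>j<n. F j l * entries_cofactor n F j k) = (if k = l then entries_det n F else 0)"
proof -
  let ?A = "mat n n (\<lambda>(i, j). F i j)"
  have A: "?A \<in> carrier_mat n n" by simp
  have "(adj_mat ?A * ?A) $$ (k, l) = (\<Sum>j<n. F j l * entries_cofactor n F j k)"
    using assms by (simp add: adj_mat_def scalar_prod_def entries_cofactor_def atLeast0LessThan mult.commute)
  thus ?thesis using assms unfolding adj_mat(3)[OF A] by (auto simp: entries_det_def)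
qed

text \<open>Both sides are the derivative of \<open>det (F (1 + \<epsilon> T))\<close> at \<open>\<epsilon> = 0\<close>.\<close>

lemma sum_entries_det_replace_row_mult:
  "(\<Sum>j<n. entries_det n (\<lambda>i k. if i = j then \<Sum>l<n. F j l * T l k else F i k)) =
    (\<Sum>l<n. T l l) * entries_det n F"
proof -
  have "(\<Sum>j<n. entries_det n (\<lambda>i k. if i = j then \<Sum>l<n. F j l * T l k else F i k)) =
    (\<Sum>j<n. \<Sum>k<n. \<Sum>l<n. T l k * (F j l * entries_cofactor n F j k))"
    by (simp add: entries_det_replace_row sum_distrib_left sum_distrib_right ac_simps)
  also have "\<dots> = (\<Sum>j<n. \<Sum>l<n. \<Sum>k<n. T l k * (F j l * entries_cofactor n F j k))"
    by (intro sum.cong refl sum.swap)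
  also have "\<dots> = (\<Sum>l<n. \<Sum>j<n. \<Sum>k<n. T l k * (F j l * entries_cofactor n F j k))"
    by (rule sum.swap)
  also have "\<dots> = (\<Sum>l<n. \<Sum>k<n. T l k * (\<Sum>j<n. F j l * entries_cofactor n F j k))"
    unfolding sum_distrib_left by (intro sum.cong refl sum.swap)
  also have "\<dots> = (\<Sum>l<n. \<Sum>k<n. if k = l then T l k * entries_det n F else 0)"
    by (intro sum.cong refl) (simp add: entries_cofactor_orthogonal)
  also have "\<dots> = (\<Sum>l<n. T l l) * entries_det n F"
    by (simp add: sum_distrib_right)
  finally show ?thesis .
qed

section \<open>Derivations\<close>

definition derivation :: "('a::comm_ring_1 \<Rightarrow> 'a) \<Rightarrow> bool" where
  "derivation \<delta> \<longleftrightarrow> (\<forall>a b. \<delta> (a + b) = \<delta> a + \<delta> b \<and> \<delta> (a * b) = a * \<delta> b + \<delta> a * b)"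

context
  fixes \<delta> :: "'a::comm_ring_1 \<Rightarrow> 'a"
  assumes derivation: "derivation \<delta>"
begin

lemma derivation_add: "\<delta> (a + b) = \<delta> a + \<delta> b"
  and derivation_mult: "\<delta> (a * b) = a * \<delta> b + \<delta> a * b"
  using derivation by (simp_all add: derivation_def)

lemma derivation_0: "\<delta> 0 = 0"
  using derivation_add[of 0 0] by simp

lemma derivation_1: "\<delta> 1 = 0"
  using derivation_mult[of 1 1] by simp

lemma derivation_uminus: "\<delta> (- a) = - \<delta> a"
  using derivation_add[of "- a" a] derivation_0 by (simp add: eq_neg_iff_add_eq_0)

lemma derivation_sum: "\<delta> (sum F I) = (\<Sum>i\<in>I. \<delta> (F i))"
  by (induction I rule: infinite_finite_induct) (auto simp: derivation_0 derivation_add)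

lemma derivation_prod:
  "finite I \<Longrightarrow> \<delta> (prod F I) = (\<Sum>j\<in>I. \<Prod>i\<in>I. if i = j then \<delta> (F i) else F i)"
proof (induction I rule: finite_induct)
  case (insert x I)
  have "(\<Prod>i\<in>I. if i = x then \<delta> (F i) else F i) = prod F I"
    using insert.hyps by (intro prod.cong) auto
  moreover have "(\<Sum>j\<in>I. \<Prod>i\<in>insert x I. if i = j then \<delta> (F i) else F i) =
      (\<Sum>j\<in>I. F x * (\<Prod>i\<in>I. if i = j then \<delta> (F i) else F i))"
    using insert.hyps by (intro sum.cong) auto
  ultimately show ?case
    using insert by (simp add: derivation_mult sum_distrib_left)
qed (simp add: derivation_1)

lemma derivation_power_Suc: "\<delta> (b ^ Suc k) = of_nat (Suc k) * b ^ k * \<delta> b"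
  by (induction k) (simp_all add: derivation_mult algebra_simps)

lemma derivation_entries_det:
  "\<delta> (entries_det n F) = (\<Sum>j<n. entries_det n (\<lambda>i k. if i = j then \<delta> (F i k) else F i k))"
proof -
  have s: "\<delta> (signof \<pi> * x) = signof \<pi> * \<delta> x" for \<pi> :: "nat \<Rightarrow> nat" and x
    by (cases \<pi> rule: sign_cases) (simp_all add: derivation_uminus)
  have "\<delta> (entries_det n F) = (\<Sum>\<pi> | \<pi> permutes {0..<n}. \<Sum>j<n.
      signof \<pi> * (\<Prod>i=0..<n. if i = j then \<delta> (F i (\<pi> i)) else F i (\<pi> i)))"
    unfolding entries_det_altdef
    by (simp add: derivation_sum s derivation_prod sum_distrib_left atLeast0LessThan)
  also have "\<dots> = (\<Sum>j<n. entries_det n (\<lambda>i k. if i = j then \<delta> (F i k) else F i k))"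
    unfolding entries_det_altdef by (rule sum.swap)
  finally show ?thesis .
qed

lemma derivation_funpow_add: "(\<delta> ^^ k) (a + b) = (\<delta> ^^ k) a + (\<delta> ^^ k) b"
  by (induction k) (auto simp: derivation_add)

lemma derivation_funpow_0: "(\<delta> ^^ k) 0 = 0"
  by (induction k) (auto simp: derivation_0)

text \<open>The extreme term of the Leibniz rule; every other term contains an iterate that vanishes.\<close>

lemma derivation_funpow_mult_top:
  "(\<delta> ^^ Suc k) a = 0 \<Longrightarrow> (\<delta> ^^ Suc l) b = 0 \<Longrightarrow>
    (\<delta> ^^ (k + l)) (a * b) = of_nat ((k + l) choose k) * (\<delta> ^^ k) a * (\<delta> ^^ l) b"
proof (induction "k + l" arbitrary: k l a b)
  case 0 thus ?case by simp
next
  case (Suc N)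
  have left: "(\<delta> ^^ N) (a * \<delta> b) =
      (if l = 0 then 0 else of_nat (N choose k) * (\<delta> ^^ k) a * (\<delta> ^^ l) b)"
  proof (cases l)
    case 0 thus ?thesis using Suc.prems by (simp add: derivation_funpow_0)
  next
    case (Suc l')
    have "(\<delta> ^^ Suc l') (\<delta> b) = 0"
      using Suc.prems(2) \<open>l = Suc l'\<close> by (simp only: funpow_Suc_right o_apply)
    thus ?thesis using Suc.hyps(1)[of k l' a "\<delta> b"] Suc.hyps(2) Suc.prems(1) \<open>l = Suc l'\<close>
      by (simp add: funpow_swap1)
  qed
  have right: "(\<delta> ^^ N) (\<delta> a * b) =
      (if k = 0 then 0 else of_nat (N choose (k - 1)) * (\<delta> ^^ k) a * (\<delta> ^^ l) b)"
  proof (cases k)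
    case 0 thus ?thesis using Suc.prems by (simp add: derivation_funpow_0)
  next
    case (Suc k')
    have "(\<delta> ^^ Suc k') (\<delta> a) = 0"
      using Suc.prems(1) \<open>k = Suc k'\<close> by (simp only: funpow_Suc_right o_apply)
    thus ?thesis using Suc.hyps(1)[of k' l "\<delta> a" b] Suc.hyps(2) Suc.prems(2) \<open>k = Suc k'\<close>
      by (simp add: funpow_swap1)
  qed
  have "(\<delta> ^^ (k + l)) (a * b) = (\<delta> ^^ N) (a * \<delta> b) + (\<delta> ^^ N) (\<delta> a * b)"
    by (simp only: Suc.hyps(2)[symmetric] funpow_Suc_right o_apply derivation_mult derivation_funpow_add)
  also have "\<dots> = of_nat ((k + l) choose k) * (\<delta> ^^ k) a * (\<delta> ^^ l) b"
  proof (cases "k = 0 \<or> l = 0")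
    case True
    thus ?thesis unfolding left right using Suc.hyps(2) by auto
  next
    case False
    then obtain k' where "k = Suc k'" by (cases k) auto
    thus ?thesis unfolding left right using False Suc.hyps(2)[symmetric] by (simp add: algebra_simps)
  qed
  finally show ?case .
qed

end

text \<open>By the extreme Leibniz term, the number of the last nonzero iterate is additive on products, like
  a degree. It is zero for \<open>a * b\<close>, hence for \<open>a\<close>.\<close>

lemma locally_nilpotent_kernel_factor:
  fixes \<delta> :: "'a::{idom,ring_char_0} \<Rightarrow> 'a"
  assumes "derivation \<delta>" "(\<delta> ^^ K) a = 0" "(\<delta> ^^ L) b = 0" "a * b \<noteq> 0" "\<delta> (a * b) = 0"
  shows "\<delta> a = 0"
proof -
  have top: "\<exists>k. (\<delta> ^^ k) x \<noteq> 0 \<and> (\<delta> ^^ Suc k) x = 0" if "(\<delta> ^^ N) x = 0" "x \<noteq> 0" for x N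
    using that
  proof (induction N)
    case (Suc N)
    thus ?case by (cases "(\<delta> ^^ N) x = 0") auto
  qed simp
  obtain k where k: "(\<delta> ^^ k) a \<noteq> 0" "(\<delta> ^^ Suc k) a = 0" using top[OF assms(2)] assms(4) by auto
  obtain l where l: "(\<delta> ^^ l) b \<noteq> 0" "(\<delta> ^^ Suc l) b = 0" using top[OF assms(3)] assms(4) by auto
  have "(\<delta> ^^ (k + l)) (a * b) \<noteq> 0"
    using derivation_funpow_mult_top[OF assms(1) k(2) l(2)] k(1) l(1) by simp
  moreover have "(\<delta> ^^ Suc i) (a * b) = 0" for i
    using assms(5) derivation_funpow_0[OF assms(1)] by (simp only: funpow_Suc_right o_apply)
  ultimately have "k + l = 0" by (cases "k + l") auto
  thus ?thesis using k(2) by simp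
qed

text \<open>The element \<open>a\<close> divides all its iterates, in particular the last nonzero one; that one lies in
  the kernel, and so do its factors.\<close>

lemma locally_nilpotent_dvd_imp_kernel:
  fixes \<delta> :: "'a::{idom,ring_char_0} \<Rightarrow> 'a"
  assumes "derivation \<delta>" and nilpotent: "\<And>x. x \<in> S \<Longrightarrow> \<exists>N. (\<delta> ^^ N) x = 0"
    and S: "a \<in> S" "\<And>x. x \<in> S \<Longrightarrow> \<delta> x \<in> S" "\<And>x y. x * y \<in> S \<Longrightarrow> x * y \<noteq> 0 \<Longrightarrow> y \<in> S"
    and "a dvd \<delta> a"
  shows "\<delta> a = 0"
proof (cases "a = 0")
  case False
  obtain N where "(\<delta> ^^ N) a = 0" using nilpotent S(1) by blast
  hence "\<exists>k. (\<delta> ^^ k) a \<noteq> 0 \<and> (\<delta> ^^ Suc k) a = 0"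
  proof (induction N)
    case (Suc N)
    thus ?case by (cases "(\<delta> ^^ N) a = 0") auto
  qed (use False in simp)
  then obtain k where k: "(\<delta> ^^ k) a \<noteq> 0" "\<delta> ((\<delta> ^^ k) a) = 0" by auto
  have "a dvd (\<delta> ^^ k) a \<and> (\<delta> ^^ k) a \<in> S" for k
  proof (induction k)
    case (Suc k)
    then obtain c where "(\<delta> ^^ k) a = a * c" by (auto elim: dvdE)
    hence "a dvd \<delta> ((\<delta> ^^ k) a)" using assms(6) by (simp add: derivation_mult[OF assms(1)])
    thus ?case using Suc S(2) by simp
  qed (use S in simp)
  then obtain c where c: "(\<delta> ^^ k) a = a * c" "a * c \<in> S" by (metis dvdE)
  have "c \<in> S" using S(3) c k(1) by metis
  then obtain L where "(\<delta> ^^ L) c = 0" using nilpotent by blast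
  with locally_nilpotent_kernel_factor[OF assms(1) \<open>(\<delta> ^^ N) a = 0\<close>] show ?thesis
    using c(1) k by metis
qed (simp add: derivation_0[OF assms(1)])

section \<open>The Jacobian modulo an invariant prime\<close>

lemma jacobian_det_eq:
  "jacobian_det p n f R = entries_det n (\<lambda>i j. pderivative j (if i < p then R i else f (i - p)))"
  by (simp add: jacobian_det_def entries_det_def)

lemma prime_in_dvd_prod:
  assumes "prime_in V b" "finite I" "\<And>i. i \<in> I \<Longrightarrow> F i \<in> polys V" "b dvd prod F I"
  shows "\<exists>i\<in>I. b dvd F i"
  using assms(2-4)
proof (induction I rule: finite_induct)
  case empty
  then obtain c where c: "1 = b * c" by (auto elim: dvdE)
  hence nz: "b \<noteq> 0" "c \<noteq> 0" by auto
  have "total_degree (b * c) = 0" using c total_degree_Const[of 1] by simp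
  thus ?case using assms(1) nz by (simp add: total_degree_mult prime_in_def)
next
  case (insert i I)
  have "b dvd F i \<or> b dvd prod F I"
    using insert assms(1) by (auto simp: prime_in_def)
  thus ?case using insert by auto
qed

lemma not_prime_in_dvd_1: "prime_in V b \<Longrightarrow> \<not> b dvd 1"
  using prime_in_dvd_prod[of V b "{}"] by auto

lemma sum_lessThan_add: "(\<Sum>r<p + m. g r) = (\<Sum>r<p. g r) + (\<Sum>i<m. g (p + i))"
  for g :: "nat \<Rightarrow> 'a::comm_monoid_add"
  by (induction m) (auto simp: ac_simps)

text \<open>Among the relations \<open>G(u) \<equiv> 0\<close> modulo \<open>b\<close>, take one of least degree in \<open>x\<close>. In characteristic
  zero its derivative \<open>w\<close> with respect to \<open>x\<close> is a nonzero polynomial of smaller degree, hence no relation. By the chain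
  rule \<open>G(u) = b q\<close> becomes a linear equation between differentials, in which \<open>du\<^sub>x\<close> has the coefficient
  \<open>w\<close>.\<close>

lemma dependent_over_prime:
  fixes u :: "nat \<Rightarrow> nat cpoly"
  assumes b: "prime_in {..<n} b" and V: "finite V" "x \<notin> V"
    and u: "\<And>v. v \<in> insert x V \<Longrightarrow> u v \<in> polys {..<n}"
    and indep: "\<And>Q. Q \<in> polys V \<Longrightarrow> b dvd subst u Q \<Longrightarrow> Q = 0"
    and dep: "Q \<in> polys (insert x V)" "b dvd subst u Q" "Q \<noteq> 0"
  shows "\<exists>w\<in>polys {..<n}. \<exists>a q. \<not> b dvd w \<and>
    (\<forall>k. b dvd w * pderivative k (u x) - ((\<Sum>v\<in>V. a v * pderivative k (u v)) + q * pderivative k b))"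
proof -
  define P where "P d \<longleftrightarrow> (\<exists>G\<in>polys (insert x V). G \<noteq> 0 \<and> b dvd subst u G \<and> var_degree_le x G d)" for d
  have "\<exists>d. P d" using dep var_degree_le_exists[of x Q] by (auto simp: P_def)
  then obtain d where "P d" and least: "\<And>d'. d' < d \<Longrightarrow> \<not> P d'"
    by (metis LeastI_ex not_less_Least)
  then obtain G where G: "G \<in> polys (insert x V)" "G \<noteq> 0" "b dvd subst u G" "var_degree_le x G d"
    by (auto simp: P_def)
  have not_polys: "G \<notin> polys V" using G indep by blast
  have Vx: "insert x V - {x} = V" using V by auto
  have "d \<noteq> 0"
    using var_degree_le_0_imp[OF _ G(1)] G(4) not_polys Vx by metis
  then obtain d' where d': "d = Suc d'" by (cases d) auto
  define w where "w = subst u (pderivative x G)"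
  have "pderivative x G \<noteq> 0"
    using pderivative_eq_0_imp_polys[OF _ G(1)] not_polys Vx by metis
  moreover have "\<not> P d'" using least d' by simp
  moreover have "pderivative x G \<in> polys (insert x V)" "var_degree_le x (pderivative x G) d'"
    using G d' pderivative_in_polys var_degree_le_pderivative by auto
  ultimately have w: "\<not> b dvd w" by (auto simp: P_def w_def)
  have wn: "w \<in> polys {..<n}" unfolding w_def
    by (rule subst_in_polys[OF pderivative_in_polys[OF G(1)] u])
  obtain q where q: "subst u G = b * q" using G(3) by (auto elim: dvdE)
  have "b dvd w * pderivative k (u x) -
      ((\<Sum>v\<in>V. - subst u (pderivative v G) * pderivative k (u v)) + q * pderivative k b)" for k
  proof -
    have "w * pderivative k (u x) + (\<Sum>v\<in>V. subst u (pderivative v G) * pderivative k (u v)) =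
        b * pderivative k q + pderivative k b * q"
      using pderivative_subst[OF G(1), of k u] V unfolding q by (simp add: w_def)
    hence "w * pderivative k (u x) -
      ((\<Sum>v\<in>V. - subst u (pderivative v G) * pderivative k (u v)) + q * pderivative k b) = b * pderivative k q"
      by (simp add: sum_negf algebra_simps)
    thus ?thesis by simp
  qed
  thus ?thesis using w wn
    by (intro bexI[of _ w] exI[of _ "\<lambda>v. - subst u (pderivative v G)"] exI[of _ q] conjI allI)
qed

text \<open>Drop one \<open>f\<^bsub>i0\<^esub>\<close> with \<open>y\<^bsub>i0\<^esub>\<close> occurring in \<open>B\<close>, where \<open>b = B(f)\<close>; the others are independent
  modulo \<open>b\<close>, since a relation between them would be a multiple of \<open>B\<close>. Add coordinates as long as
  this independence lasts; the dimension count allows at most \<open>p\<close> of them, and they make up \<open>R\<close>. Now each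
  coordinate \<open>x\<^sub>j\<close> depends on the chosen functions modulo \<open>b\<close>, so a multiple \<open>w\<^sub>j dx\<^sub>j\<close> is
  a combination of their differentials and of \<open>db = \<Sum> \<partial>B/\<partial>y\<^sub>i(f) df\<^sub>i\<close>. In matrices, the diagonal of
  the \<open>w\<^sub>j\<close> is congruent to a product with the Jacobian matrix of \<open>(R, f)\<close> as a factor; as \<open>b\<close> does
  not divide \<open>\<Prod> w\<^sub>j\<close>, it does not divide the Jacobian determinant.\<close>

lemma jacobian_det_nonzero_modulo_prime:
  fixes n p :: nat and f :: "nat \<Rightarrow> nat cpoly"
  defines "m \<equiv> n - p"
  defines "A \<equiv> subst f ` polys {..<m}"
  assumes pn: "p \<le> n" and f: "\<And>i. i < m \<Longrightarrow> f i \<in> polys {..<n}"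
    and independent: "\<And>Q. Q \<in> polys {..<m} \<Longrightarrow> subst f Q = 0 \<Longrightarrow> Q = 0"
    and factor: "\<And>P Q. P * Q \<in> A \<Longrightarrow> P * Q \<noteq> 0 \<Longrightarrow> Q \<in> A"
    and b: "prime_in {..<n} b" "b \<in> A"
  shows "\<exists>R. (\<forall>j<p. R j \<in> polys {..<n}) \<and> \<not> b dvd jacobian_det p n f R"
proof -
  have b0: "b \<noteq> 0" "total_degree b > 0" and bS: "b \<in> polys {..<n}" using b(1) by (auto simp: prime_in_def)
  obtain B where B: "B \<in> polys {..<m}" "b = subst f B" using b(2) by (auto simp: A_def)
  have "\<exists>i0<m. B \<notin> polys ({..<m} - {i0})"
  proof (rule ccontr)
    assume "\<not> ?thesis"
    hence "B \<in> polys {}" using B(1) unfolding polys_def by blast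
    hence "\<exists>c. B = Const c"
      by (induction B rule: polys_induct) (auto simp flip: Const_add Const_mult)
    thus False using B(2) b0(2) by auto
  qed
  then obtain i0 where i0: "i0 < m" "B \<notin> polys ({..<m} - {i0})" by blast
  define V0 where "V0 = {..<m} - {i0}"
  \<comment> \<open>The functions \<open>f\<close> have the indices below \<open>m\<close>, and the coordinate \<open>x\<^sub>j\<close> has the index \<open>m + j\<close>.\<close>
  define u where "u k = (if k < m then f k else Var (k - m))" for k
  have uS: "u k \<in> polys {..<n}" if "k < m + n" for k
    using that f by (auto simp: u_def)
  define indep where "indep V \<longleftrightarrow> (\<forall>Q\<in>polys V. b dvd subst u Q \<longrightarrow> Q = 0)" for V
  have subst_u: "subst u Q = subst f Q" if "Q \<in> polys {..<m}" for Q
    by (rule subst_cong[OF that]) (simp add: u_def)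
  have "indep V0"
    unfolding indep_def
  proof (intro ballI impI, rule ccontr)
    fix Q assume Q: "Q \<in> polys V0" "b dvd subst u Q" "Q \<noteq> 0"
    have Qm: "Q \<in> polys {..<m}" using Q(1) polys_mono[of V0 "{..<m}"] by (auto simp: V0_def)
    then obtain q where q: "subst f Q = b * q" using Q(2) subst_u by (auto elim: dvdE)
    have "subst f Q \<noteq> 0" using independent[OF Qm] Q(3) by blast
    moreover have "subst f Q \<in> A" using Qm by (simp add: A_def)
    ultimately have "q \<in> A" using factor[of b q] q by auto
    then obtain H where H: "H \<in> polys {..<m}" "q = subst f H" by (auto simp: A_def)
    have "Q - H * B = 0"
      by (rule independent) (use Qm H B q in \<open>auto simp: mult.commute\<close>)
    hence "Q = H * B" by simp
    hence "B \<in> polys V0" using polys_factor[of H B V0] Q by simp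
    thus False using i0(2) by (simp add: V0_def)
  qed
  define ext where "ext I = V0 \<union> (+) m ` I" for I
  have "{I. I \<subseteq> {..<n} \<and> indep (ext I)} \<noteq> {}"
    using \<open>indep V0\<close> by (auto simp: ext_def intro!: exI[of _ "{}"])
  moreover have "finite {I. I \<subseteq> {..<n} \<and> indep (ext I)}"
    by (rule finite_subset[of _ "Pow {..<n}"]) auto
  ultimately obtain I where I: "I \<subseteq> {..<n}" "indep (ext I)"
    and maximal: "\<And>I'. I' \<subseteq> {..<n} \<Longrightarrow> indep (ext I') \<Longrightarrow> I \<subseteq> I' \<Longrightarrow> I = I'"
    using finite_has_maximal[of "{I. I \<subseteq> {..<n} \<and> indep (ext I)}"] by auto
  define V where "V = ext I"
  have finI: "finite I" using I(1) finite_subset by blast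
  have finV: "finite V" using finI by (simp add: V_def ext_def V0_def)
  have disj: "V0 \<inter> (+) m ` I = {}" by (auto simp: V0_def)
  have Vlt: "v < m + n" if "v \<in> V" for v using that I(1) by (auto simp: V_def ext_def V0_def)
  have "\<not> n \<le> card V"
  proof
    assume "n \<le> card V"
    hence "\<exists>Q\<in>polys V. Q \<noteq> 0 \<and> b dvd subst u Q"
      using finV bS b0(1) uS Vlt by (intro algebraically_dependent_modulo[where W = "{..<n}"]) auto
    thus False using I(2) by (auto simp: indep_def V_def)
  qed
  moreover have "card V = m - 1 + card I"
    using disj finI i0(1) by (simp add: V_def ext_def V0_def card_Un_disjoint card_image)
  ultimately have cI: "card I \<le> p" using i0(1) pn by (simp add: m_def)
  define relation where "relation j w a q \<longleftrightarrow> w \<in> polys {..<n} \<and> \<not> b dvd w \<and>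
    (\<forall>k. b dvd (if j = k then w else 0) - ((\<Sum>v\<in>V. a v * pderivative k (u v)) + q * pderivative k b))"
    for j w a q
  have ex: "\<exists>w a q. relation j w a q" if j: "j < n" for j
  proof (cases "j \<in> I")
    case True
    hence "m + j \<in> V" by (simp add: V_def ext_def)
    moreover have "(\<Sum>v\<in>V. (if v = m + j then 1 else 0) * pderivative k (u v)) =
        (\<Sum>v\<in>V. if v = m + j then pderivative k (Var j) else 0)" for k
      by (rule sum.cong) (auto simp: u_def)
    ultimately have "(if j = k then 1 else 0) -
      ((\<Sum>v\<in>V. (if v = m + j then 1 else 0) * pderivative k (u v)) + 0 * pderivative k b) = 0" for k
      using finV by (simp add: pderivative_Var)
    thus ?thesis using not_prime_in_dvd_1[OF b(1)] unfolding relation_def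
      by (intro exI[of _ 1] exI[of _ "\<lambda>v. if v = m + j then 1 else 0"] exI[of _ 0]) simp
  next
    case False
    have x: "m + j \<notin> V" using False by (auto simp: V_def ext_def V0_def)
    have ins: "ext (insert j I) = insert (m + j) V" by (auto simp: ext_def V_def)
    have "\<not> indep (insert (m + j) V)"
      using maximal[of "insert j I"] False I(1) j ins by auto
    then obtain Q where Q: "Q \<in> polys (insert (m + j) V)" "b dvd subst u Q" "Q \<noteq> 0"
      by (auto simp: indep_def)
    have dep: "\<exists>w\<in>polys {..<n}. \<exists>a q. \<not> b dvd w \<and> (\<forall>k. b dvd w * pderivative k (u (m + j)) -
        ((\<Sum>v\<in>V. a v * pderivative k (u v)) + q * pderivative k b))"
      by (rule dependent_over_prime[OF b(1) finV x _ _ Q])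
        (use uS Vlt j I(2) in \<open>auto simp: indep_def V_def\<close>)
    have eq: "w * pderivative k (u (m + j)) = (if j = k then w else 0)" for w k
      by (simp add: u_def pderivative_Var)
    from dep obtain w a q where "w \<in> polys {..<n}" "\<not> b dvd w" "\<forall>k. b dvd w * pderivative k (u (m + j)) -
        ((\<Sum>v\<in>V. a v * pderivative k (u v)) + q * pderivative k b)" by blast
    hence "relation j w a q" unfolding eq relation_def by blast
    thus ?thesis by blast
  qed
  define w where "w j = (SOME w. \<exists>a q. relation j w a q)" for j
  define a where "a j = (SOME a. \<exists>q. relation j (w j) a q)" for j
  define q where "q j = (SOME q. relation j (w j) (a j) q)" for j
  have "relation j (w j) (a j) (q j)" if "j < n" for j
  proof -
    have 1: "\<exists>a q. relation j (w j) a q" unfolding w_def by (rule someI_ex[OF ex[OF that]])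
    have 2: "\<exists>q. relation j (w j) (a j) q" unfolding a_def by (rule someI_ex[OF 1])
    show ?thesis unfolding q_def by (rule someI_ex[OF 2])
  qed
  hence w: "\<And>j. j < n \<Longrightarrow> w j \<in> polys {..<n}" "\<And>j. j < n \<Longrightarrow> \<not> b dvd w j"
    and rel: "\<And>j k. j < n \<Longrightarrow> b dvd (if j = k then w j else 0) -
      ((\<Sum>v\<in>V. a j v * pderivative k (u v)) + q j * pderivative k b)"
    unfolding relation_def by blast+
  obtain h where h: "bij_betw h {..<card I} I"
    using ex_bij_betw_nat_finite[OF finI] by (auto simp: atLeast0LessThan)
  \<comment> \<open>If there are fewer than \<open>p\<close> coordinates, zero rows fill up the matrix.\<close>
  define R where "R r = (if r < card I then Var (h r) else 0)" for r
  have R: "R j \<in> polys {..<n}" for j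
    using h I(1) by (auto simp: R_def bij_betw_def intro!: Var_in_polys)
  define M where "M r k = pderivative k (if r < p then R r else f (r - p))" for r k
  \<comment> \<open>The coefficients of \<open>w\<^sub>j dx\<^sub>j\<close>; those of \<open>db\<close> are spread over all the \<open>df\<^sub>i\<close>.\<close>
  define C where "C j r = (if r < p then if r < card I then a j (m + h r) else 0
    else (if r - p \<noteq> i0 then a j (r - p) else 0) + q j * subst f (pderivative (r - p) B))" for j r
  have CM: "(\<Sum>r<n. C j r * M r k) = (\<Sum>v\<in>V. a j v * pderivative k (u v)) + q j * pderivative k b" for j k
  proof -
    have "(\<Sum>r<n. C j r * M r k) = (\<Sum>r<p. C j r * M r k) + (\<Sum>i<m. C j (p + i) * M (p + i) k)"
      using sum_lessThan_add[of "\<lambda>r. C j r * M r k" p m] pn by (simp add: m_def)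
    also have "(\<Sum>r<p. C j r * M r k) = (\<Sum>r<card I. a j (m + h r) * pderivative k (u (m + h r)))"
      using cI by (intro sum.mono_neutral_cong_right) (auto simp: C_def M_def R_def u_def)
    also have "\<dots> = (\<Sum>i\<in>I. a j (m + i) * pderivative k (u (m + i)))"
      by (rule sum.reindex_bij_betw[OF h])
    also have "\<dots> = (\<Sum>v\<in>(+) m ` I. a j v * pderivative k (u v))"
      by (simp add: sum.reindex)
    also have "(\<Sum>i<m. C j (p + i) * M (p + i) k) =
        (\<Sum>i<m. (if i \<noteq> i0 then a j i * pderivative k (u i) else 0)) +
        q j * (\<Sum>i<m. subst f (pderivative i B) * pderivative k (f i))"
      unfolding sum_distrib_left sum.distrib[symmetric]
      by (intro sum.cong refl) (auto simp: C_def M_def u_def algebra_simps)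
    also have "(\<Sum>i<m. (if i \<noteq> i0 then a j i * pderivative k (u i) else 0)) =
        (\<Sum>v\<in>V0. a j v * pderivative k (u v))"
      by (intro sum.mono_neutral_cong_right) (auto simp: V0_def)
    also have "(\<Sum>i<m. subst f (pderivative i B) * pderivative k (f i)) = pderivative k b"
      unfolding B(2) by (rule pderivative_subst[OF B(1), symmetric]) simp
    also have "(\<Sum>v\<in>(+) m ` I. a j v * pderivative k (u v)) +
        ((\<Sum>v\<in>V0. a j v * pderivative k (u v)) + q j * pderivative k b) =
        (\<Sum>v\<in>V. a j v * pderivative k (u v)) + q j * pderivative k b"
      using disj finI by (simp add: V_def ext_def V0_def sum.union_disjoint)
    finally show ?thesis .
  qed
  have "b dvd entries_det n (\<lambda>j k. if j = k then w j else 0) -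
      entries_det n (\<lambda>j k. \<Sum>r<n. C j r * M r k)"
    by (rule dvd_entries_det_diff) (unfold CM, rule rel)
  hence diff: "b dvd (\<Prod>j<n. w j) - entries_det n C * jacobian_det p n f R"
    unfolding entries_det_mult entries_det_diagonal jacobian_det_eq M_def .
  have "\<not> b dvd jacobian_det p n f R"
  proof
    assume "b dvd jacobian_det p n f R"
    hence "b dvd entries_det n C * jacobian_det p n f R" by (rule dvd_mult)
    from dvd_add[OF diff this] have "b dvd (\<Prod>j<n. w j)" by simp
    hence "\<exists>j\<in>{..<n}. b dvd w j" by (intro prime_in_dvd_prod[OF b(1)]) (use w in auto)
    thus False using w(2) by auto
  qed
  thus ?thesis using R by blast
qed

section \<open>The derivations of an algebraic action\<close>

text \<open>The coordinates of \<open>\<phi>(t,x)\<close>, with points as functions on the natural numbers, so that no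
  dimensions have to be carried along.\<close>

definition flow :: "(nat \<Rightarrow> (nat + nat) cpoly) \<Rightarrow> (nat \<Rightarrow> complex) \<Rightarrow> (nat \<Rightarrow> complex) \<Rightarrow> nat \<Rightarrow> complex" where
  "flow \<Phi> t x k = eval_at (case_sum t x) (\<Phi> k)"

text \<open>The derivation \<open>\<partial>\<^sub>i\<close> written by the chain rule. On polynomials in the \<open>n\<close> coordinates it agrees with
  \<open>action_derivation\<close>, but it satisfies the product rule on the whole ring, whatever the components of
  \<open>\<Phi>\<close> beyond \<open>n\<close> are.\<close>

definition vector_field :: "nat \<Rightarrow> (nat \<Rightarrow> (nat + nat) cpoly) \<Rightarrow> nat \<Rightarrow> nat cpoly \<Rightarrow> nat cpoly" where
  "vector_field n \<Phi> i P = (\<Sum>k<n. action_derivation \<Phi> i (Var k) * pderivative k P)"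

lemma eval_at_subst_flow: "eval_at (case_sum t x) (subst \<Phi> P) = eval_at (flow \<Phi> t x) P"
  by (simp add: eval_at_subst flow_def[abs_def])

lemma eval_at_subst_zero_section:
  fixes Q :: "('a + nat) cpoly"
  shows "eval_at x (subst (case_sum (\<lambda>_. 0) Var) Q) = eval_at (case_sum (\<lambda>_. 0) x) Q"
proof -
  have "(\<lambda>v :: 'a + nat. eval_at x (case_sum (\<lambda>_. 0) Var v)) = case_sum (\<lambda>_. 0) x"
    by (auto split: sum.split)
  thus ?thesis by (simp only: eval_at_subst)
qed

lemma case_sum_decompose: "g = case_sum (g \<circ> Inl) (g \<circ> Inr)"
  by (auto split: sum.split)

lemma derivation_vector_field: "derivation (vector_field n \<Phi> i)"
  by (auto simp: derivation_def vector_field_def sum.distrib sum_distrib_left algebra_simps)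

context
  fixes p n :: nat and \<Phi> :: "nat \<Rightarrow> (nat + nat) cpoly"
  assumes action: "algebraic_action p n \<Phi>"
begin

lemma action_in_polys: "k < n \<Longrightarrow> \<Phi> k \<in> polys ({..<p} <+> {..<n})"
  using action by (simp add: algebraic_action_def)

lemma flow_cong:
  assumes "k < n" "\<And>i. i < p \<Longrightarrow> t i = t' i" "\<And>i. i < n \<Longrightarrow> x i = x' i"
  shows "flow \<Phi> t x k = flow \<Phi> t' x' k"
  unfolding flow_def by (rule eval_at_cong[OF action_in_polys[OF assms(1)]]) (use assms in auto)

lemma regular_map_eq_flow:
  assumes "u \<in> carrier_vec p" "y \<in> carrier_vec n"
    and "\<And>i. i < p \<Longrightarrow> u $ i = t i" "\<And>i. i < n \<Longrightarrow> y $ i = x i"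
  shows "regular_map n \<Phi> u y = vec n (flow \<Phi> t x)"
proof (rule eq_vecI)
  fix k assume k: "k < dim_vec (vec n (flow \<Phi> t x))"
  hence "flow \<Phi> (($) u) (($) y) k = flow \<Phi> t x k" using assms by (intro flow_cong) auto
  thus "regular_map n \<Phi> u y $ k = vec n (flow \<Phi> t x) $ k"
    using k by (simp add: regular_map_def flow_def)
qed (simp add: regular_map_def)

lemma flow_0: "k < n \<Longrightarrow> flow \<Phi> (\<lambda>_. 0) x k = x k"
proof -
  assume k: "k < n"
  have "regular_map n \<Phi> (0\<^sub>v p) (vec n x) = vec n x"
    using action by (simp add: algebraic_action_def)
  moreover have "regular_map n \<Phi> (0\<^sub>v p) (vec n x) = vec n (flow \<Phi> (\<lambda>_. 0) x)"
    by (rule regular_map_eq_flow) auto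
  ultimately have "vec n (flow \<Phi> (\<lambda>_. 0) x) $ k = vec n x $ k" by simp
  thus ?thesis using k by simp
qed

lemma flow_add: "k < n \<Longrightarrow> flow \<Phi> s (flow \<Phi> t x) k = flow \<Phi> (\<lambda>i. s i + t i) x k"
proof -
  assume k: "k < n"
  have "regular_map n \<Phi> (vec p s) (regular_map n \<Phi> (vec p t) (vec n x)) =
      regular_map n \<Phi> (vec p s + vec p t) (vec n x)"
    using action by (simp add: algebraic_action_def)
  moreover have "regular_map n \<Phi> (vec p t) (vec n x) = vec n (flow \<Phi> t x)"
    by (rule regular_map_eq_flow) auto
  moreover have "regular_map n \<Phi> (vec p s) (vec n (flow \<Phi> t x)) = vec n (flow \<Phi> s (flow \<Phi> t x))"
    by (rule regular_map_eq_flow) auto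
  moreover have "regular_map n \<Phi> (vec p s + vec p t) (vec n x) = vec n (flow \<Phi> (\<lambda>i. s i + t i) x)"
    by (rule regular_map_eq_flow) auto
  ultimately have "vec n (flow \<Phi> s (flow \<Phi> t x)) $ k = vec n (flow \<Phi> (\<lambda>i. s i + t i) x) $ k" by simp
  thus ?thesis using k by simp
qed

lemma invariants_iff_flow:
  "P \<in> invariants p n \<Phi> \<longleftrightarrow> P \<in> polys {..<n} \<and> (\<forall>t x. eval_at (flow \<Phi> t x) P = eval_at x P)"
proof (cases "P \<in> polys {..<n}")
  case P: True
  have eq: "eval_at (($) (regular_map n \<Phi> u y)) P = eval_at (($) y) P \<longleftrightarrow>
      eval_at (flow \<Phi> t x) P = eval_at x P"
    if "u \<in> carrier_vec p" "y \<in> carrier_vec n" "\<And>i. i < p \<Longrightarrow> u $ i = t i" "\<And>i. i < n \<Longrightarrow> y $ i = x i"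
    for u y t x
  proof -
    have "eval_at (($) (regular_map n \<Phi> u y)) P = eval_at (flow \<Phi> t x) P"
      by (rule eval_at_cong[OF P]) (subst regular_map_eq_flow[OF that], auto)
    moreover have "eval_at (($) y) P = eval_at x P"
      by (rule eval_at_cong[OF P]) (use that in simp)
    ultimately show ?thesis by simp
  qed
  show ?thesis
  proof
    assume inv: "P \<in> invariants p n \<Phi>"
    have "eval_at (flow \<Phi> t x) P = eval_at x P" for t x
    proof -
      have "eval_at (($) (regular_map n \<Phi> (vec p t) (vec n x))) P = eval_at (($) (vec n x)) P"
        using inv unfolding invariants_def by simp
      thus ?thesis using eq[of "vec p t" "vec n x" t x] by simp
    qed
    thus "P \<in> polys {..<n} \<and> (\<forall>t x. eval_at (flow \<Phi> t x) P = eval_at x P)" using P by blast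
  next
    assume "P \<in> polys {..<n} \<and> (\<forall>t x. eval_at (flow \<Phi> t x) P = eval_at x P)"
    thus "P \<in> invariants p n \<Phi>" using eq P unfolding invariants_def by blast
  qed
qed (simp add: invariants_def)

lemma subst_action_in_polys: "P \<in> polys {..<n} \<Longrightarrow> subst \<Phi> P \<in> polys ({..<p} <+> {..<n})"
  by (rule subst_in_polys) (auto intro: action_in_polys)

lemma zero_section_in_polys:
  "Q \<in> polys ({..<p} <+> {..<n}) \<Longrightarrow> subst (case_sum (\<lambda>_. 0) Var) Q \<in> polys {..<n}"
  by (erule subst_in_polys) auto

lemma zero_section_subst_action:
  assumes "P \<in> polys {..<n}" shows "subst (case_sum (\<lambda>_. 0) Var) (subst \<Phi> P) = P"
proof (rule eq_if_eval_at_eq)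
  show "subst (case_sum (\<lambda>_. 0) Var) (subst \<Phi> P) \<in> polys {..<n}"
    by (intro zero_section_in_polys subst_action_in_polys assms)
  fix x
  show "eval_at x (subst (case_sum (\<lambda>_. 0) Var) (subst \<Phi> P)) = eval_at x P"
    unfolding eval_at_subst_zero_section eval_at_subst_flow
    by (rule eval_at_cong[OF assms]) (simp add: flow_0)
qed (use assms in auto)

lemma action_derivation_in_polys: "P \<in> polys {..<n} \<Longrightarrow> action_derivation \<Phi> i P \<in> polys {..<n}"
  unfolding action_derivation_def
  by (intro zero_section_in_polys pderivative_in_polys subst_action_in_polys)

lemma action_derivation_eq_vector_field:
  assumes "P \<in> polys {..<n}" shows "action_derivation \<Phi> i P = vector_field n \<Phi> i P"
  using assms
proof (induction P rule: polys_induct)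
  case (Const c)
  show ?case by (simp add: action_derivation_def vector_field_def)
next
  case (Var k)
  have "vector_field n \<Phi> i (Var k) = (\<Sum>l<n. if l = k then action_derivation \<Phi> i (Var l) else 0)"
    unfolding vector_field_def by (rule sum.cong) (auto simp: pderivative_Var)
  thus ?case using Var by simp
next
  case (add A B)
  have "action_derivation \<Phi> i (A + B) = action_derivation \<Phi> i A + action_derivation \<Phi> i B"
    by (simp add: action_derivation_def)
  thus ?case using add by (simp add: derivation_add[OF derivation_vector_field])
next
  case (mult A B)
  have "action_derivation \<Phi> i (A * B) = A * action_derivation \<Phi> i B + action_derivation \<Phi> i A * B"
    using mult.hyps by (simp add: action_derivation_def zero_section_subst_action)
  thus ?case using mult by (simp add: derivation_mult[OF derivation_vector_field])
qed

lemma vector_field_in_polys: "P \<in> polys {..<n} \<Longrightarrow> vector_field n \<Phi> i P \<in> polys {..<n}"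
  using action_derivation_in_polys action_derivation_eq_vector_field by metis

text \<open>By the group law, differentiating \<open>P(\<phi>(t,x))\<close> at any time \<open>t\<close> is differentiating at time
  zero with the starting point \<open>\<phi>(t,x)\<close>.\<close>

lemma pderivative_subst_action:
  assumes P: "P \<in> polys {..<n}"
  shows "pderivative (Inl i) (subst \<Phi> P) = subst \<Phi> (vector_field n \<Phi> i P)"
proof (rule eq_if_eval_at_eq)
  show "pderivative (Inl i) (subst \<Phi> P) \<in> polys ({..<p} <+> {..<n})"
    by (intro pderivative_in_polys subst_action_in_polys P)
  show "subst \<Phi> (vector_field n \<Phi> i P) \<in> polys ({..<p} <+> {..<n})"
    by (intro vector_field_in_polys subst_action_in_polys P)
  fix g :: "nat + nat \<Rightarrow> complex"
  define t x where "t = g \<circ> Inl" and "x = g \<circ> Inr"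
  have g: "g = case_sum t x" unfolding t_def x_def by (rule case_sum_decompose)
  have upd: "(case_sum s y)(Inl i := case_sum s y (Inl i) + z) = case_sum (s(i := s i + z)) y"
    for s y and z :: complex
    by (auto split: sum.split)
  have path: "eval_at (flow \<Phi> ((\<lambda>_. 0)(i := 0 + z)) (flow \<Phi> t x)) P = eval_at (flow \<Phi> (t(i := t i + z)) x) P" for z
  proof (rule eval_at_cong[OF P])
    fix k assume "k \<in> {..<n}"
    thus "flow \<Phi> ((\<lambda>_. 0)(i := 0 + z)) (flow \<Phi> t x) k = flow \<Phi> (t(i := t i + z)) x k"
      by (subst flow_add) (auto intro: flow_cong)
  qed
  have "((\<lambda>z. eval_at (flow \<Phi> (t(i := t i + z)) x) P) has_field_derivative
      eval_at (case_sum t x) (pderivative (Inl i) (subst \<Phi> P))) (at 0)"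
    using has_field_derivative_eval_at[of "case_sum t x" "Inl i" "subst \<Phi> P"]
    unfolding upd eval_at_subst_flow .
  moreover have "((\<lambda>z. eval_at (flow \<Phi> (t(i := t i + z)) x) P) has_field_derivative
      eval_at (case_sum (\<lambda>_. 0) (flow \<Phi> t x)) (pderivative (Inl i) (subst \<Phi> P))) (at 0)"
    using has_field_derivative_eval_at[of "case_sum (\<lambda>_. 0) (flow \<Phi> t x)" "Inl i" "subst \<Phi> P"]
    unfolding upd eval_at_subst_flow path .
  ultimately have "eval_at (case_sum t x) (pderivative (Inl i) (subst \<Phi> P)) =
      eval_at (case_sum (\<lambda>_. 0) (flow \<Phi> t x)) (pderivative (Inl i) (subst \<Phi> P))"
    by (rule DERIV_unique)
  also have "\<dots> = eval_at (flow \<Phi> t x) (action_derivation \<Phi> i P)"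
    by (simp add: action_derivation_def eval_at_subst_zero_section)
  finally show "eval_at g (pderivative (Inl i) (subst \<Phi> P)) = eval_at g (subst \<Phi> (vector_field n \<Phi> i P))"
    unfolding g eval_at_subst_flow using action_derivation_eq_vector_field[OF P] by simp
qed auto

lemma vector_field_eq_zero_section:
  "P \<in> polys {..<n} \<Longrightarrow>
    vector_field n \<Phi> i P = subst (case_sum (\<lambda>_. 0) Var) (pderivative (Inl i) (subst \<Phi> P))"
  using action_derivation_eq_vector_field by (simp add: action_derivation_def)

text \<open>Both sides are the mixed second derivative of \<open>P(\<phi>(t,x))\<close> in \<open>t\<close> at \<open>t = 0\<close>.\<close>

lemma vector_field_commute:
  assumes "P \<in> polys {..<n}"
  shows "vector_field n \<Phi> i (vector_field n \<Phi> j P) = vector_field n \<Phi> j (vector_field n \<Phi> i P)"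
  using assms
  by (simp add: vector_field_eq_zero_section[OF vector_field_in_polys] flip: pderivative_subst_action)
    (subst pderivative_commute, rule refl)

text \<open>The iterates are the higher derivatives of \<open>P(\<phi>(t,x))\<close> at \<open>t = 0\<close>, and this is a polynomial in \<open>t\<^sub>i\<close>.\<close>

lemma vector_field_locally_nilpotent:
  assumes "P \<in> polys {..<n}" shows "\<exists>N. (vector_field n \<Phi> i ^^ N) P = 0"
proof -
  have iter: "(vector_field n \<Phi> i ^^ N) P \<in> polys {..<n} \<and>
      subst \<Phi> ((vector_field n \<Phi> i ^^ N) P) = (pderivative (Inl i) ^^ N) (subst \<Phi> P)" for N
    by (induction N) (use assms in \<open>auto simp: vector_field_in_polys simp flip: pderivative_subst_action\<close>)
  obtain d where "var_degree_le (Inl i) (subst \<Phi> P) d" using var_degree_le_exists[of "Inl i" "subst \<Phi> P"] ..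
  hence "subst \<Phi> ((vector_field n \<Phi> i ^^ Suc d) P) = 0"
    using iter[of "Suc d"] pderivative_funpow_eq_0 by metis
  hence "(vector_field n \<Phi> i ^^ Suc d) P = 0"
    using zero_section_subst_action[of "(vector_field n \<Phi> i ^^ Suc d) P"] iter[of "Suc d"] by simp
  thus ?thesis ..
qed

text \<open>Invariance means that \<open>P(\<phi>(t,x))\<close> does not contain \<open>t\<close>, and its derivative with respect to \<open>t\<^sub>i\<close> is
  \<open>(\<partial>\<^sub>i P)(\<phi>(t,x))\<close>.\<close>

lemma invariants_iff_vector_field:
  "P \<in> invariants p n \<Phi> \<longleftrightarrow> P \<in> polys {..<n} \<and> (\<forall>i<p. vector_field n \<Phi> i P = 0)"
proof (cases "P \<in> polys {..<n}")
  case P: True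
  have "(\<forall>t x. eval_at (flow \<Phi> t x) P = eval_at x P) \<longleftrightarrow> (\<forall>i<p. vector_field n \<Phi> i P = 0)"
  proof
    assume inv: "\<forall>t x. eval_at (flow \<Phi> t x) P = eval_at x P"
    have in_x: "subst (\<lambda>k. Var (Inr k)) P \<in> polys (Inr ` {..<n})"
      by (rule subst_in_polys[OF P]) auto
    have "subst \<Phi> P = subst (\<lambda>k. Var (Inr k)) P"
    proof (rule eq_if_eval_at_eq)
      show "subst (\<lambda>k. Var (Inr k)) P \<in> polys ({..<p} <+> {..<n})"
        using in_x by (rule subsetD[OF polys_mono, rotated]) auto
      fix g :: "nat + nat \<Rightarrow> complex"
      have "eval_at g (subst \<Phi> P) = eval_at (g \<circ> Inr) P"
        using inv eval_at_subst_flow[of "g \<circ> Inl" "g \<circ> Inr" \<Phi> P] case_sum_decompose[of g] by simp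
      thus "eval_at g (subst \<Phi> P) = eval_at g (subst (\<lambda>k. Var (Inr k)) P)"
        by (simp add: eval_at_subst comp_def)
    qed (use subst_action_in_polys[OF P] in auto)
    hence "pderivative (Inl i) (subst \<Phi> P) = 0" for i
      using pderivative_outside[OF in_x] by auto
    thus "\<forall>i<p. vector_field n \<Phi> i P = 0" using vector_field_eq_zero_section[OF P] by simp
  next
    assume "\<forall>i<p. vector_field n \<Phi> i P = 0"
    hence "\<And>i. i < p \<Longrightarrow> pderivative (Inl i) (subst \<Phi> P) = 0"
      using pderivative_subst_action[OF P] by simp
    hence no_t: "Inl i \<notin> Poly_Mapping.keys m" if "m \<in> Poly_Mapping.keys (subst \<Phi> P)" "i < p" for m i
      using pderivative_eq_0_imp that by (metis in_keys_iff)
    have in_x: "subst \<Phi> P \<in> polys (Inr ` {..<n})"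
      unfolding polys_def
    proof (clarify)
      fix m v assume m: "m \<in> Poly_Mapping.keys (subst \<Phi> P)" and v: "v \<in> Poly_Mapping.keys m"
      hence "v \<in> {..<p} <+> {..<n}"
        using subst_action_in_polys[OF P] by (auto simp: polys_def)
      thus "v \<in> Inr ` {..<n}" using no_t[OF m] v by auto
    qed
    show "\<forall>t x. eval_at (flow \<Phi> t x) P = eval_at x P"
    proof (intro allI)
      fix t x
      have "eval_at (case_sum t x) (subst \<Phi> P) = eval_at (case_sum (\<lambda>_. 0) x) (subst \<Phi> P)"
        by (rule eval_at_cong[OF in_x]) auto
      thus "eval_at (flow \<Phi> t x) P = eval_at x P"
        using zero_section_subst_action[OF P] eval_at_subst_zero_section[of x "subst \<Phi> P"]
        by (simp add: eval_at_subst_flow)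
    qed
  qed
  thus ?thesis using invariants_iff_flow P by blast
qed (simp add: invariants_def)

lemma invariants_factor:
  assumes "P * Q \<in> invariants p n \<Phi>" "P * Q \<noteq> 0" shows "Q \<in> invariants p n \<Phi>"
proof -
  have PQ: "Q * P \<in> polys {..<n}" "Q * P \<noteq> 0"
    using assms by (simp_all add: invariants_def mult.commute)
  have QS: "Q \<in> polys {..<n}" "P \<in> polys {..<n}"
    using polys_factor[of Q P] polys_factor[of P Q] PQ by (simp_all add: mult.commute)
  have "vector_field n \<Phi> i Q = 0" if "i < p" for i
  proof -
    have "vector_field n \<Phi> i (Q * P) = 0"
      using assms(1) that by (simp add: invariants_iff_vector_field mult.commute)
    thus ?thesis
      using vector_field_locally_nilpotent[OF QS(1)] vector_field_locally_nilpotent[OF QS(2)] PQ(2)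
        locally_nilpotent_kernel_factor[OF derivation_vector_field] by blast
  qed
  thus ?thesis using QS invariants_iff_vector_field by blast
qed

lemma semi_invariant_imp_kernel:
  assumes "P \<in> polys {..<n}" "P dvd vector_field n \<Phi> i P" shows "vector_field n \<Phi> i P = 0"
  by (rule locally_nilpotent_dvd_imp_kernel[OF derivation_vector_field, of "polys {..<n}"])
    (use assms vector_field_locally_nilpotent vector_field_in_polys polys_factor in blast)+

lemma subalgebra_invariants: "subalgebra (invariants p n \<Phi>)"
  by (auto simp: subalgebra_def invariants_iff_flow)

section \<open>Generators of the ring of invariants\<close>

lemma invariants_eq_subst:
  assumes "generators_of m f (invariants p n \<Phi>)"
  shows "invariants p n \<Phi> = subst f ` polys {..<m}"
proof
  have hull: "subalgebra hull (f ` {..<m}) = invariants p n \<Phi>"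
    using assms by (simp add: generators_of_def)
  have "subalgebra (subst f ` polys {..<m})"
    unfolding subalgebra_def
  proof (intro conjI ballI subsetI)
    fix x :: "nat cpoly" assume "x \<in> range Const"
    then obtain c where "x = Const c" by auto
    thus "x \<in> subst f ` polys {..<m}" by (intro image_eqI[of _ _ "Const c"]) simp_all
  next
    fix x y assume x: "x \<in> subst f ` polys {..<m}" and y: "y \<in> subst f ` polys {..<m}"
    from x obtain P where P: "x = subst f P" "P \<in> polys {..<m}" by (rule imageE)
    from y obtain Q where Q: "y = subst f Q" "Q \<in> polys {..<m}" by (rule imageE)
    show "x + y \<in> subst f ` polys {..<m}"
      by (rule image_eqI[of _ _ "P + Q"]) (use P Q in simp_all)
    show "x * y \<in> subst f ` polys {..<m}"
      by (rule image_eqI[of _ _ "P * Q"]) (use P Q in simp_all)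
  qed
  moreover have "f ` {..<m} \<subseteq> subst f ` polys {..<m}"
  proof
    fix x assume "x \<in> f ` {..<m}"
    then obtain i where "i < m" "x = f i" by auto
    thus "x \<in> subst f ` polys {..<m}" by (intro image_eqI[of _ _ "Var i"]) simp_all
  qed
  ultimately show "invariants p n \<Phi> \<subseteq> subst f ` polys {..<m}"
    unfolding hull[symmetric] by (intro hull_minimal)
  have f: "f i \<in> invariants p n \<Phi>" if "i < m" for i
    using hull_subset[of "f ` {..<m}" subalgebra] that unfolding hull by blast
  have "subst f P \<in> invariants p n \<Phi>" if "P \<in> polys {..<m}" for P
    using that
    by (induction P rule: polys_induct) (use f subalgebra_invariants in \<open>auto simp: subalgebra_def\<close>)
  thus "subst f ` polys {..<m} \<subseteq> invariants p n \<Phi>" by blast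
qed

text \<open>Count once more: the variables are polynomials \<open>H\<^sub>i\<close> in the generators, and a relation \<open>Q\<close> between
  the generators divides some nonzero \<open>P(H\<^sub>0, \<dots>)\<close>. Inserting the generators gives \<open>P = 0\<close>, a
  contradiction.\<close>

lemma generators_independent:
  assumes "condition_H p n \<Phi>" "generators_of (n - p) f (invariants p n \<Phi>)"
    and Q: "Q \<in> polys {..<n - p}" "subst f Q = 0"
  shows "Q = 0"
proof (rule ccontr)
  assume Q0: "Q \<noteq> 0"
  define m where "m = n - p"
  note inv = invariants_eq_subst[OF assms(2), folded m_def]
  obtain \<psi> where bij: "bij_betw \<psi> (invariants p n \<Phi>) (polys {..<m} :: nat cpoly set)"
    and \<psi>_Const: "\<And>c. \<psi> (Const c) = Const c"
    and \<psi>: "\<And>P Q. P \<in> invariants p n \<Phi> \<Longrightarrow> Q \<in> invariants p n \<Phi> \<Longrightarrow>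
      \<psi> (P + Q) = \<psi> P + \<psi> Q \<and> \<psi> (P * Q) = \<psi> P * \<psi> Q"
    using assms(1) by (auto simp: condition_H_def algebra_isomorphic_def m_def)
  define g where "g i = \<psi> (f i)" for i
  have \<psi>_subst: "\<psi> (subst f H) = subst g H" if "H \<in> polys {..<m}" for H
    using that by (induction H rule: polys_induct) (auto simp: \<psi>_Const g_def \<psi> inv)
  have "\<exists>H\<in>polys {..<m}. subst g H = Var i" if "i < m" for i
  proof -
    have "(Var i :: nat cpoly) \<in> \<psi> ` invariants p n \<Phi>" using bij that by (simp add: bij_betw_def)
    thus ?thesis using \<psi>_subst unfolding inv by force
  qed
  then obtain H where H: "\<And>i. i < m \<Longrightarrow> H i \<in> polys {..<m}" "\<And>i. i < m \<Longrightarrow> subst g (H i) = Var i"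
    by metis
  have Qm: "Q \<in> polys {..<m}" using Q(1) by (simp add: m_def)
  obtain P where P: "P \<in> polys {..<m}" "P \<noteq> 0" "Q dvd subst H P"
    using algebraically_dependent_modulo[of "{..<m}" "{..<m}" Q H] Qm Q0 H(1) by auto
  then obtain q where q: "subst H P = Q * q" by (auto elim: dvdE)
  have "subst g Q = \<psi> (Const 0)" using \<psi>_subst[OF Qm] Q(2) by simp
  hence "subst g Q = 0" using \<psi>_Const[of 0] by simp
  hence "subst g (subst H P) = 0" unfolding q by simp
  moreover have "subst g (subst H P) = subst Var P"
    unfolding subst_subst by (rule subst_cong[OF P(1)]) (simp add: H(2))
  ultimately show False using P(2) by simp
qed

end

section \<open>Comparing the two determinants\<close>

text \<open>The last sum is the row \<open>dP\<close> multiplied by the Jacobian matrix of the vector field.\<close>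

lemma pderivative_vector_field:
  "pderivative k (vector_field n \<Phi> i P) = vector_field n \<Phi> i (pderivative k P) +
    (\<Sum>l<n. pderivative l P * pderivative k (action_derivation \<Phi> i (Var l)))"
proof -
  have "pderivative k (vector_field n \<Phi> i P) =
      (\<Sum>l<n. action_derivation \<Phi> i (Var l) * pderivative k (pderivative l P) +
        pderivative l P * pderivative k (action_derivation \<Phi> i (Var l)))"
    by (simp add: vector_field_def pderivative_sum ac_simps)
  thus ?thesis
    by (simp add: vector_field_def sum.distrib pderivative_commute[of k] add.commute)
qed

text \<open>Differentiate the determinant row by row. The vector field commutes with \<open>d\<close> up to its own Jacobian
  matrix \<open>T\<close>. In the rows of the \<open>f\<close>s, which it kills, only the contribution of \<open>T\<close> is left; over all rows
  the contributions of \<open>T\<close> add up to the trace of \<open>T\<close>, the divergence of the field.\<close>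

lemma vector_field_jacobian_det:
  assumes f: "\<And>j. j < n - p \<Longrightarrow> vector_field n \<Phi> i (f j) = 0" and pn: "p \<le> n"
  shows "vector_field n \<Phi> i (jacobian_det p n f R) =
    (\<Sum>j<p. jacobian_det p n f (R(j := vector_field n \<Phi> i (R j)))) -
    (\<Sum>l<n. pderivative l (action_derivation \<Phi> i (Var l))) * jacobian_det p n f R"
proof -
  let ?D = "vector_field n \<Phi> i"
  define h where "h r = (if r < p then R r else f (r - p))" for r
  define M where "M r k = pderivative k (h r)" for r k
  define T where "T l k = pderivative k (action_derivation \<Phi> i (Var l))" for l k
  have J: "jacobian_det p n f R = entries_det n M"
    by (simp add: jacobian_det_eq M_def[abs_def] h_def)
  have row: "entries_det n (\<lambda>r k. if r = j then ?D (M r k) else M r k) =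
      entries_det n (\<lambda>r k. if r = j then pderivative k (?D (h j)) else M r k) -
      entries_det n (\<lambda>r k. if r = j then \<Sum>l<n. M j l * T l k else M r k)" if j: "j < n" for j
  proof -
    have "entries_det n (\<lambda>r k. if r = j then ?D (M r k) else M r k) =
        entries_det n (\<lambda>r k. if r = j then ?D (M j k) else M r k)"
      by (rule entries_det_cong) auto
    moreover have "?D (M j k) = pderivative k (?D (h j)) - (\<Sum>l<n. M j l * T l k)" for k
      by (simp add: M_def T_def pderivative_vector_field)
    ultimately show ?thesis
      by (simp add: entries_det_replace_row[OF j] left_diff_distrib sum_subtractf)
  qed
  have "?D (entries_det n M) =
      (\<Sum>j<n. entries_det n (\<lambda>r k. if r = j then pderivative k (?D (h j)) else M r k)) -
      (\<Sum>j<n. entries_det n (\<lambda>r k. if r = j then \<Sum>l<n. M j l * T l k else M r k))"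
    unfolding derivation_entries_det[OF derivation_vector_field] by (simp add: row sum_subtractf)
  also have "(\<Sum>j<n. entries_det n (\<lambda>r k. if r = j then pderivative k (?D (h j)) else M r k)) =
      (\<Sum>j<p. jacobian_det p n f (R(j := ?D (R j))))"
  proof (rule sum.mono_neutral_cong_right)
    show "\<forall>j\<in>{..<n} - {..<p}. entries_det n (\<lambda>r k. if r = j then pderivative k (?D (h j)) else M r k) = 0"
    proof
      fix j assume j: "j \<in> {..<n} - {..<p}"
      hence "?D (h j) = 0" by (auto simp: h_def intro!: f)
      thus "entries_det n (\<lambda>r k. if r = j then pderivative k (?D (h j)) else M r k) = 0"
        using j by (subst entries_det_replace_row) auto
    qed
    fix j assume "j \<in> {..<p}"
    thus "entries_det n (\<lambda>r k. if r = j then pderivative k (?D (h j)) else M r k) =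
        jacobian_det p n f (R(j := ?D (R j)))"
      unfolding jacobian_det_eq by (intro entries_det_cong) (auto simp: M_def h_def)
  qed (use pn in auto)
  finally show ?thesis
    unfolding J sum_entries_det_replace_row_mult by (simp add: T_def)
qed

lemma jacobian_det_in_polys:
  assumes "\<And>j. j < p \<Longrightarrow> R j \<in> polys V" "\<And>j. j < n - p \<Longrightarrow> f j \<in> polys V"
  shows "jacobian_det p n f R \<in> polys V"
  unfolding jacobian_det_eq by (intro entries_det_in_polys pderivative_in_polys) (use assms in auto)

context
  fixes p n :: nat and \<Phi> :: "nat \<Rightarrow> (nat + nat) cpoly" and f :: "nat \<Rightarrow> nat cpoly"
  assumes action: "algebraic_action p n \<Phi>"
    and H: "condition_H p n \<Phi>"
    and gens: "generators_of (n - p) f (invariants p n \<Phi>)"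
begin

lemma p_le_n: "p \<le> n"
  using H by (simp add: condition_H_def)

lemma generator_invariant: "j < n - p \<Longrightarrow> f j \<in> invariants p n \<Phi>"
  unfolding invariants_eq_subst[OF action gens]
  by (rule image_eqI[of _ _ "Var j"]) auto

lemma generator_in_polys: "j < n - p \<Longrightarrow> f j \<in> polys {..<n}"
  using generator_invariant by (auto simp: invariants_def)

lemma generator_kernel: "j < n - p \<Longrightarrow> i < p \<Longrightarrow> vector_field n \<Phi> i (f j) = 0"
  using generator_invariant invariants_iff_vector_field[OF action] by blast

lemma vector_field_jacobian:
  "i < p \<Longrightarrow> vector_field n \<Phi> i (jacobian_det p n f R) =
    (\<Sum>j<p. jacobian_det p n f (R(j := vector_field n \<Phi> i (R j)))) -
    (\<Sum>l<n. pderivative l (action_derivation \<Phi> i (Var l))) * jacobian_det p n f R"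
  by (rule vector_field_jacobian_det) (simp_all add: generator_kernel p_le_n)

lemma jacobian_in_polys:
  "(\<And>j. j < p \<Longrightarrow> R j \<in> polys {..<n}) \<Longrightarrow> jacobian_det p n f R \<in> polys {..<n}"
  by (rule jacobian_det_in_polys) (auto intro: generator_in_polys)

text \<open>The irreducible factors of \<open>f\<^sub>0\<close> are invariant primes, so the result modulo primes applies to one of
  them. Without generators, the coordinates have Jacobian determinant one.\<close>

lemma jacobian_nonzero_modulo_invariant_prime:
  assumes "prime_in {..<n} b" "b \<in> invariants p n \<Phi>"
  shows "\<exists>R. (\<forall>j<p. R j \<in> polys {..<n}) \<and> \<not> b dvd jacobian_det p n f R"
proof (rule jacobian_det_nonzero_modulo_prime[OF p_le_n generator_in_polys _ _ assms(1)])
  show "b \<in> subst f ` polys {..<n - p}" using assms(2) invariants_eq_subst[OF action gens] by simp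
  show "Q = 0" if "Q \<in> polys {..<n - p}" "subst f Q = 0" for Q
    using generators_independent[OF action H gens that] .
  show "Q \<in> subst f ` polys {..<n - p}"
    if "P * Q \<in> subst f ` polys {..<n - p}" "P * Q \<noteq> 0" for P Q
    using invariants_factor[OF action, of P Q] that by (simp add: invariants_eq_subst[OF action gens])
qed

lemma jacobian_nonzero:
  "\<exists>R. (\<forall>j<p. R j \<in> polys {..<n}) \<and> jacobian_det p n f R \<noteq> 0"
proof (cases "n = p")
  case True
  have "jacobian_det p n f Var = entries_det n (\<lambda>i j. if i = j then 1 else 0)"
    unfolding jacobian_det_eq by (rule entries_det_cong) (auto simp: pderivative_Var True)
  hence "jacobian_det p n f Var = 1" by (simp add: entries_det_diagonal)
  thus ?thesis using p_le_n by (intro exI[of _ Var]) auto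
next
  case False
  hence m: "0 < n - p" using p_le_n by simp
  have "total_degree (f 0) > 0"
  proof (rule ccontr)
    assume "\<not> total_degree (f 0) > 0"
    then obtain c where "f 0 = Const c" using total_degree_eq_0_imp by auto
    hence "subst f (Var 0 - Const c) = 0" by simp
    hence "Var 0 - Const c = (0 :: nat cpoly)"
      using generators_independent[OF action H gens, of "Var 0 - Const c"] m by simp
    hence "pderivative 0 (Var 0 - Const c) = (0 :: nat cpoly)" by simp
    moreover have "pderivative 0 (Var 0 - Const c) + pderivative 0 (Const c) = pderivative 0 (Var 0 :: nat cpoly)"
      unfolding pderivative_add[symmetric] by simp
    ultimately show False by (simp add: pderivative_Var)
  qed
  then obtain b where b: "irreducible_in {..<n} b" "b dvd f 0"
    using exists_irreducible_factor[OF generator_in_polys[OF m]] by blast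
  from b(2) obtain c where "f 0 = b * c" ..
  hence c: "f 0 = c * b" by (simp only: mult.commute)
  have "c * b \<noteq> 0" using \<open>total_degree (f 0) > 0\<close> c by auto
  hence "b \<in> invariants p n \<Phi>"
    using invariants_factor[OF action, of c b] generator_invariant[OF m] c by simp
  then obtain R where "\<forall>j<p. R j \<in> polys {..<n}" "\<not> b dvd jacobian_det p n f R"
    using jacobian_nonzero_modulo_invariant_prime irreducible_in_imp_prime_in[OF _ b(1)] by blast
  thus ?thesis by (intro exI[of _ R]) auto
qed

text \<open>Let \<open>b\<^sup>k\<close> be the highest power that divides all values \<open>J R\<close>, and \<open>J R = b\<^sup>k j\<close> a value with \<open>b\<close>
  not dividing \<open>j\<close>. Then \<open>\<partial>\<^sub>i (J R)\<close> is divisible by \<open>b\<^sup>k\<close> as well, and in its expansion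
  \<open>b\<^sup>k \<partial>\<^sub>i j + k b\<^bsup>k-1\<^esup> j \<partial>\<^sub>i b\<close> this leaves only that \<open>b\<close> divides \<open>\<partial>\<^sub>i b\<close>.\<close>

lemma prime_divisor_of_jacobian_invariant:
  assumes b: "prime_in {..<n} b"
    and dvd: "\<And>R. (\<And>j. j < p \<Longrightarrow> R j \<in> polys {..<n}) \<Longrightarrow> b dvd jacobian_det p n f R"
  shows "b \<in> invariants p n \<Phi>"
proof -
  let ?S = "polys {..<n} :: nat cpoly set"
  have bS: "b \<in> ?S" and b0: "b \<noteq> 0" and degb: "total_degree b > 0"
    using b by (auto simp: prime_in_def)
  define admissible where "admissible R \<longleftrightarrow> (\<forall>j<p. R j \<in> ?S)" for R :: "nat \<Rightarrow> nat cpoly"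
  define divides where "divides k \<longleftrightarrow> (\<forall>R. admissible R \<longrightarrow> b ^ k dvd jacobian_det p n f R)" for k
  obtain R0 where R0: "admissible R0" "jacobian_det p n f R0 \<noteq> 0"
    using jacobian_nonzero by (auto simp: admissible_def)
  have bound: "k \<le> total_degree (jacobian_det p n f R0)" if "divides k" for k
  proof -
    have "b ^ k dvd jacobian_det p n f R0" using that R0 by (simp add: divides_def)
    then obtain c where c: "jacobian_det p n f R0 = b ^ k * c" by (auto elim: dvdE)
    have "total_degree (b ^ k) \<ge> k" for k
    proof (induction k)
      case (Suc k)
      thus ?case using degb b0 by (simp add: total_degree_mult)
    qed simp
    from this[of k] show ?thesis using c R0(2) b0 by (auto simp: total_degree_mult)
  qed
  have div1: "divides 1" using dvd by (simp add: divides_def admissible_def)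
  define k where "k = (GREATEST k. divides k)"
  have k: "divides k" "\<And>l. divides l \<Longrightarrow> l \<le> k"
    unfolding k_def using GreatestI_nat[of divides, OF div1] Greatest_le_nat[of divides] bound by blast+
  obtain k' where k': "k = Suc k'" using k(2)[OF div1] by (cases k) auto
  have "\<not> divides (Suc k)" using k(2)[of "Suc k"] by auto
  then obtain R where R: "admissible R" "\<not> b ^ Suc k dvd jacobian_det p n f R"
    by (auto simp: divides_def)
  obtain j where j: "jacobian_det p n f R = b ^ k * j"
    using k(1) R(1) by (auto simp: divides_def elim: dvdE)
  have nb: "\<not> b dvd j"
  proof
    assume "b dvd j"
    hence "b ^ k * b dvd b ^ k * j" by (rule mult_dvd_mono[OF dvd_refl])
    thus False using R(2) j by (simp add: mult.commute)
  qed
  hence j0: "j \<noteq> 0" by auto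
  have "b ^ k * j \<in> ?S" using jacobian_in_polys R(1) j by (metis admissible_def)
  hence jS: "j \<in> ?S" using polys_factor j0 b0 by (metis mult_eq_0_iff power_not_zero)
  have "vector_field n \<Phi> i b = 0" if i: "i < p" for i
  proof -
    let ?D = "vector_field n \<Phi> i"
    have "b ^ k dvd ?D (jacobian_det p n f R)"
      unfolding vector_field_jacobian[OF i]
    proof (intro dvd_diff dvd_sum dvd_mult)
      fix l assume "l \<in> {..<p}"
      hence "admissible (R(l := ?D (R l)))"
        using R(1) vector_field_in_polys[OF action] by (auto simp: admissible_def)
      thus "b ^ k dvd jacobian_det p n f (R(l := ?D (R l)))" using k(1) by (simp add: divides_def)
    qed (use k(1) R(1) in \<open>simp add: divides_def\<close>)
    moreover have "?D (b ^ k * j) = b ^ k * ?D j + of_nat k * b ^ k' * ?D b * j"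
      unfolding k' by (simp only: derivation_mult[OF derivation_vector_field]
          derivation_power_Suc[OF derivation_vector_field])
    ultimately have "b ^ k dvd b ^ k * ?D j + of_nat k * b ^ k' * ?D b * j" unfolding j by simp
    hence "b ^ k dvd of_nat k * b ^ k' * ?D b * j" by (simp add: dvd_add_right_iff)
    hence "b ^ k' * b dvd b ^ k' * (of_nat k * (?D b * j))" unfolding k' by (simp add: ac_simps)
    hence "b dvd of_nat k * (?D b * j)" using b0 by simp
    hence "b dvd Const (inverse (of_nat k)) * (of_nat k * (?D b * j))" by (rule dvd_mult)
    moreover have "Const (of_nat k) = (of_nat k :: nat cpoly)"
      by (induction k) (simp_all add: Const_add)
    hence "Const (inverse (of_nat k)) * (of_nat k :: nat cpoly) = 1"
      using k' by (metis Const_1 Const_mult left_inverse of_nat_eq_0_iff nat.distinct(1))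
    ultimately have "b dvd ?D b * j" by (simp add: mult.assoc[symmetric])
    hence "b dvd ?D b"
      using b nb jS vector_field_in_polys[OF action bS] by (auto simp: prime_in_def)
    thus ?thesis using semi_invariant_imp_kernel[OF action bS] by blast
  qed
  thus ?thesis using bS invariants_iff_vector_field[OF action] by blast
qed

lemma derivation_det_eq:
  assumes "\<And>j. j < p \<Longrightarrow> R j \<in> polys {..<n}"
  shows "derivation_det p \<Phi> R = entries_det p (\<lambda>j i. vector_field n \<Phi> i (R j))"
proof -
  have "derivation_det p \<Phi> R = entries_det p (\<lambda>i j. vector_field n \<Phi> i (R j))"
    unfolding derivation_det_def entries_det_def[symmetric]
    by (rule entries_det_cong) (simp add: action_derivation_eq_vector_field[OF action] assms)
  thus ?thesis using entries_det_transpose[of p "\<lambda>j i. vector_field n \<Phi> i (R j)"] by simp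
qed

text \<open>Differentiate row by row; \<open>\<partial>\<^sub>i\<close> commutes with the other derivations.\<close>

lemma vector_field_derivation_det:
  assumes R: "\<And>j. j < p \<Longrightarrow> R j \<in> polys {..<n}"
  shows "vector_field n \<Phi> i (derivation_det p \<Phi> R) =
    (\<Sum>j<p. derivation_det p \<Phi> (R(j := vector_field n \<Phi> i (R j))))"
proof -
  let ?D = "vector_field n \<Phi>"
  have "entries_det p (\<lambda>r l. if r = j then ?D i (?D l (R r)) else ?D l (R r)) =
      derivation_det p \<Phi> (R(j := ?D i (R j)))" if "j < p" for j
  proof -
    have "derivation_det p \<Phi> (R(j := ?D i (R j))) =
        entries_det p (\<lambda>r l. ?D l ((R(j := ?D i (R j))) r))"
      by (rule derivation_det_eq) (use R vector_field_in_polys[OF action] in auto)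
    also have "\<dots> = entries_det p (\<lambda>r l. if r = j then ?D i (?D l (R r)) else ?D l (R r))"
      by (rule entries_det_cong) (use vector_field_commute[OF action R] in auto)
    finally show ?thesis by simp
  qed
  thus ?thesis
    by (simp add: derivation_det_eq[OF R] derivation_entries_det[OF derivation_vector_field])
qed

text \<open>Multiply the Jacobian matrix of \<open>(R, f)\<close> by the matrix whose first \<open>p\<close> columns are the vector
  fields and whose other columns are those of the adjugate of one fixed nonsingular Jacobian matrix.
  As the fields kill the \<open>f\<close>s, the product is block triangular: the upper left block is the matrix of the
  \<open>\<partial>\<^sub>i R\<^sub>j\<close>, and the lower right block is scalar by the choice of the adjugate.\<close>

lemma derivation_det_proportional:
  "\<exists>h\<in>polys {..<n}. \<exists>a\<in>polys {..<n}. h \<noteq> 0 \<and>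
    (\<forall>R. (\<forall>j<p. R j \<in> polys {..<n}) \<longrightarrow> h * derivation_det p \<Phi> R = a * jacobian_det p n f R)"
proof -
  let ?D = "vector_field n \<Phi>"
  define m where "m = n - p"
  have n: "n = p + m" using p_le_n by (simp add: m_def)
  obtain R0 where R0: "\<forall>j<p. R0 j \<in> polys {..<n}" "jacobian_det p n f R0 \<noteq> 0"
    using jacobian_nonzero by blast
  define M where "M R r k = pderivative k (if r < p then R r else f (r - p))"
    for R :: "nat \<Rightarrow> nat cpoly" and r k
  have J: "jacobian_det p n f R = entries_det n (M R)" for R
    by (simp add: jacobian_det_eq M_def[abs_def])
  define h0 where "h0 = jacobian_det p n f R0"
  define N where "N l c = (if c < p then action_derivation \<Phi> c (Var l)
    else entries_cofactor n (M R0) c l)" for l c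
  have MS: "M R0 r k \<in> polys {..<n}" if "r < n" for r k
    unfolding M_def using R0(1) generator_in_polys that by (intro pderivative_in_polys) auto
  have "entries_cofactor n (M R0) c l \<in> polys {..<n}" if "c < n" "l < n" for c l
  proof -
    have "entries_cofactor n (M R0) c l = (\<Sum>k<n. (if k = l then 1 else 0) * entries_cofactor n (M R0) c k)"
      using that by (simp add: if_distrib if_distribR cong: if_cong)
    also have "\<dots> = entries_det n (\<lambda>r k. if r = c then if k = l then 1 else 0 else M R0 r k)"
      by (rule entries_det_replace_row[OF that(1), symmetric])
    also have "\<dots> \<in> polys {..<n}" by (rule entries_det_in_polys) (use MS in auto)
    finally show ?thesis .
  qed
  hence NS: "entries_det n N \<in> polys {..<n}"
    by (intro entries_det_in_polys) (auto simp: N_def intro!: action_derivation_in_polys[OF action])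
  have rows: "(\<Sum>l<n. M R0 r l * entries_cofactor n (M R0) c l) = (if r = c then h0 else 0)"
    if "r < n" "c < n" for r c
  proof -
    let ?A = "mat n n (\<lambda>(i, j). M R0 i j)"
    have A: "?A \<in> carrier_mat n n" by simp
    have "(?A * adj_mat ?A) $$ (r, c) = (\<Sum>l<n. M R0 r l * entries_cofactor n (M R0) c l)"
      using that by (simp add: adj_mat_def scalar_prod_def entries_cofactor_def atLeast0LessThan)
    thus ?thesis using that unfolding adj_mat(2)[OF A] h0_def J by (auto simp: entries_det_def)
  qed
  have "h0 ^ m * derivation_det p \<Phi> R = entries_det n N * jacobian_det p n f R"
    if R: "\<forall>j<p. R j \<in> polys {..<n}" for R
  proof -
    define X where "X r c = (\<Sum>l<n. M R r l * N l c)" for r c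
    have X_field: "X r c = ?D c (if r < p then R r else f (r - p))" if "c < p" for r c
      using that by (simp add: X_def N_def M_def vector_field_def mult.commute)
    have X_adj: "X r c = (if r = c then h0 else 0)" if "p \<le> r" "r < n" "p \<le> c" "c < n" for r c
    proof -
      have "X r c = (\<Sum>l<n. M R0 r l * entries_cofactor n (M R0) c l)"
        using that by (simp add: X_def N_def M_def)
      thus ?thesis using rows that by simp
    qed
    let ?A1 = "mat p p (\<lambda>(r, c). ?D c (R r))" and ?A2 = "mat p m (\<lambda>(r, c). X r (p + c))"
      and ?A4 = "mat m m (\<lambda>(r, c). if r = c then h0 else 0)"
    have "mat n n (\<lambda>(r, c). X r c) = four_block_mat ?A1 ?A2 (0\<^sub>m m p) ?A4"
    proof (rule eq_matI)
      fix r c assume "r < dim_row (four_block_mat ?A1 ?A2 (0\<^sub>m m p) ?A4)"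
        "c < dim_col (four_block_mat ?A1 ?A2 (0\<^sub>m m p) ?A4)"
      hence rc: "r < n" "c < n" by (simp_all add: n)
      show "mat n n (\<lambda>(r, c). X r c) $$ (r, c) = four_block_mat ?A1 ?A2 (0\<^sub>m m p) ?A4 $$ (r, c)"
      proof (cases "r < p")
        case True
        thus ?thesis using rc by (cases "c < p") (auto simp: X_field n)
      next
        case False
        show ?thesis
        proof (cases "c < p")
          case True
          have "?D c (f (r - p)) = 0" using False rc True by (intro generator_kernel) auto
          thus ?thesis using False rc True by (simp add: X_field n)
        next
          case c: False
          thus ?thesis using False rc by (auto simp: X_adj n)
        qed
      qed
    qed (simp_all add: n)
    hence "entries_det n X = det (four_block_mat ?A1 ?A2 (0\<^sub>m m p) ?A4)" by (simp add: entries_det_def)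
    also have "\<dots> = det ?A1 * det ?A4"
      by (rule det_four_block_mat_lower_left_zero) auto
    also have "det ?A1 = derivation_det p \<Phi> R"
      using derivation_det_eq[of R] R by (simp add: entries_det_def)
    also have "det ?A4 = h0 ^ m"
      using entries_det_diagonal[of m "\<lambda>_. h0"] by (simp add: entries_det_def)
    finally have "entries_det n X = derivation_det p \<Phi> R * h0 ^ m" .
    moreover have "entries_det n X = jacobian_det p n f R * entries_det n N"
      unfolding J X_def[abs_def] by (rule entries_det_mult)
    ultimately show ?thesis by (simp add: mult.commute)
  qed
  moreover have "h0 ^ m \<noteq> 0" "h0 ^ m \<in> polys {..<n}"
    using R0 jacobian_in_polys by (auto simp: h0_def)
  ultimately show ?thesis using NS by blast
qed

text \<open>A prime factor of \<open>h\<close> that did not divide \<open>a\<close> would divide all values of \<open>J\<close>, hence be invariant, and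
  \<open>J\<close> does not vanish modulo invariant primes. So the prime factors of \<open>h\<close> cancel one by one.\<close>

lemma cancel_denominator:
  assumes "h \<in> polys {..<n}" "a \<in> polys {..<n}" "h \<noteq> 0"
    and "\<And>R. (\<forall>j<p. R j \<in> polys {..<n}) \<Longrightarrow> h * derivation_det p \<Phi> R = a * jacobian_det p n f R"
  shows "\<exists>E\<in>polys {..<n}. \<forall>R. (\<forall>j<p. R j \<in> polys {..<n}) \<longrightarrow>
    derivation_det p \<Phi> R = E * jacobian_det p n f R"
  using assms
proof (induction "total_degree h" arbitrary: h a rule: less_induct)
  case less
  show ?case
  proof (cases "total_degree h = 0")
    case True
    then obtain c where c: "h = Const c" using total_degree_eq_0_imp by blast
    hence inv: "Const (inverse c) * h = 1" using less.prems(3) by (simp add: Const_mult[symmetric])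
    have "derivation_det p \<Phi> R = (Const (inverse c) * a) * jacobian_det p n f R"
      if "\<forall>j<p. R j \<in> polys {..<n}" for R
    proof -
      have "derivation_det p \<Phi> R = Const (inverse c) * (h * derivation_det p \<Phi> R)"
        using inv by (simp add: mult.assoc[symmetric])
      thus ?thesis unfolding less.prems(4)[OF that] by (simp add: mult.assoc)
    qed
    moreover have "Const (inverse c) * a \<in> polys {..<n}" using less.prems(2) by simp
    ultimately show ?thesis by blast
  next
    case False
    then obtain b where "irreducible_in {..<n} b" "b dvd h"
      using exists_irreducible_factor[OF less.prems(1)] by auto
    hence b: "prime_in {..<n} b" using irreducible_in_imp_prime_in by blast
    obtain h' where h': "h = b * h'" using \<open>b dvd h\<close> by (auto elim: dvdE)
    have nz: "b \<noteq> 0" "h' \<noteq> 0" using h' less.prems(3) by auto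
    have "b dvd a"
    proof (rule ccontr)
      assume na: "\<not> b dvd a"
      have dvd: "b dvd jacobian_det p n f R" if R: "\<And>j. j < p \<Longrightarrow> R j \<in> polys {..<n}" for R
      proof -
        have "a * jacobian_det p n f R = h * derivation_det p \<Phi> R"
          by (rule less.prems(4)[symmetric]) (use R in blast)
        also have "\<dots> = b * (h' * derivation_det p \<Phi> R)" by (simp only: h' mult.assoc)
        finally have "b dvd a * jacobian_det p n f R" ..
        moreover have "jacobian_det p n f R \<in> polys {..<n}" by (rule jacobian_in_polys) (rule R)
        ultimately show ?thesis using b na less.prems(2) unfolding prime_in_def by blast
      qed
      hence "b \<in> invariants p n \<Phi>" by (rule prime_divisor_of_jacobian_invariant[OF b])
      thus False using jacobian_nonzero_modulo_invariant_prime[OF b] dvd by blast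
    qed
    then obtain a' where a': "a = b * a'" by (auto elim: dvdE)
    have "h' \<in> polys {..<n}" using polys_factor less.prems(1,3) h' by blast
    moreover have "a' \<in> polys {..<n}"
    proof (cases "a = 0")
      case False
      thus ?thesis using polys_factor less.prems(2) a' by blast
    qed (use a' nz in simp)
    moreover have "total_degree h' < total_degree h"
      using h' nz b by (simp add: total_degree_mult prime_in_def)
    moreover have "h' * derivation_det p \<Phi> R = a' * jacobian_det p n f R"
      if "\<forall>j<p. R j \<in> polys {..<n}" for R
    proof -
      have "b * (h' * derivation_det p \<Phi> R) = b * (a' * jacobian_det p n f R)"
        using less.prems(4)[OF that] h' a' by (simp only: mult.assoc)
      thus ?thesis using nz by simp
    qed
    ultimately show ?thesis using less.hyps nz(2) by blast
  qed
qed

text \<open>Comparing the derivatives of the two sides yields \<open>\<partial>\<^sub>i E = \<tau> E\<close>, where \<open>\<tau>\<close> is the divergence of \<open>\<partial>\<^sub>i\<close>.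
  So \<open>E\<close> divides \<open>\<partial>\<^sub>i E\<close>, which must then vanish by local nilpotency.\<close>

lemma quotient_invariant:
  assumes E: "E \<in> polys {..<n}"
    and eq: "\<And>R. (\<And>j. j < p \<Longrightarrow> R j \<in> polys {..<n}) \<Longrightarrow> derivation_det p \<Phi> R = E * jacobian_det p n f R"
  shows "E \<in> invariants p n \<Phi>"
proof -
  obtain R where R: "\<And>j. j < p \<Longrightarrow> R j \<in> polys {..<n}" and J: "jacobian_det p n f R \<noteq> 0"
    using jacobian_nonzero by blast
  have "vector_field n \<Phi> i E = 0" if i: "i < p" for i
  proof -
    let ?D = "vector_field n \<Phi> i"
    define \<tau> where "\<tau> = (\<Sum>l<n. pderivative l (action_derivation \<Phi> i (Var l)))"
    have "?D (E * jacobian_det p n f R) = (\<Sum>j<p. derivation_det p \<Phi> (R(j := ?D (R j))))"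
      using vector_field_derivation_det[OF R] eq[OF R] by simp
    also have "\<dots> = (\<Sum>j<p. E * jacobian_det p n f (R(j := ?D (R j))))"
      by (intro sum.cong refl eq) (use R vector_field_in_polys[OF action] in auto)
    also have "\<dots> = E * (?D (jacobian_det p n f R) + \<tau> * jacobian_det p n f R)"
      unfolding vector_field_jacobian[OF i]
      by (simp add: sum_distrib_left \<tau>_def)
    finally have "?D E * jacobian_det p n f R = E * \<tau> * jacobian_det p n f R"
      by (simp add: derivation_mult[OF derivation_vector_field] algebra_simps)
    hence "?D E = E * \<tau>" using J by simp
    hence "E dvd ?D E" by simp
    thus ?thesis by (rule semi_invariant_imp_kernel[OF action E])
  qed
  thus ?thesis using E invariants_iff_vector_field[OF action] by blast
qed

end

theorem proposition1p7:
  fixes p n :: nat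
    and \<Phi> :: "nat \<Rightarrow> (nat + nat) cpoly"
    and f :: "nat \<Rightarrow> nat cpoly"
  assumes "algebraic_action p n \<Phi>"
    and "condition_H p n \<Phi>"
    and "generators_of (n - p) f (invariants p n \<Phi>)"
  shows "\<exists>E \<in> invariants p n \<Phi>.
    \<forall>R. (\<forall>j<p. R j \<in> polys {..<n}) \<longrightarrow>
      derivation_det p \<Phi> R = E * jacobian_det p n f R"
proof -
  obtain h a where "h \<in> polys {..<n}" "a \<in> polys {..<n}" "h \<noteq> 0"
    "\<And>R. (\<forall>j<p. R j \<in> polys {..<n}) \<Longrightarrow> h * derivation_det p \<Phi> R = a * jacobian_det p n f R"
    using derivation_det_proportional[OF assms] by blast
  then obtain E where E: "E \<in> polys {..<n}"
    "\<forall>R. (\<forall>j<p. R j \<in> polys {..<n}) \<longrightarrow> derivation_det p \<Phi> R = E * jacobian_det p n f R"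
    using cancel_denominator[OF assms] by blast
  moreover have "E \<in> invariants p n \<Phi>"
    by (rule quotient_invariant[OF assms E(1)]) (use E(2) in blast)
  ultimately show ?thesis by blast
qed

end
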